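(* Let $f:\mathbb{E}\to\mathbb{R}$ be $p$-times differentiable, $p\ge2$, not necessarily convex, bounded from below by $f^*$, and let $\nu\in[0,1]$ satisfy $H_{f,p}(\nu)<+\infty$. Let $\epsilon\in(0,1)$ and let $\{x_t\}_{t=0}^T$ be generated by Algorithm 1 (described in the context) with $\|\nabla f(x_t)\|_*>\epsilon$ for $t=0,\ldots,T$. Then, both when $\nu$ is known ($\alpha=\nu$) and when $\nu$ is unknown ($\alpha=1$), $$T\le\mathcal{O}\left(\epsilon^{-\frac{p+\nu}{p+\nu-1}}\right),$$ where the constant in $\mathcal{O}(\cdot)$ does not depend on $\epsilon\in(0,1)$ or $T$ (it depends only on $p,\nu,\theta,H_0,H_{f,p}(\nu)$ and $f(x_0)-f^*$).
   Context: **Notation.** $\mathbb{E}$ is a finite-dimensional real vector space with dual $\mathbb{E}^*$, $B:\mathbb{E}\to\mathbb{E}^*$ is a fixed self-adjoint positive definite operator, $\|x\|=\langle Bx,x\rangle^{1/2}$ and $\|s\|_*=\langle s,B^{-1}s\rangle^{1/2}$. $D^if(x)[h]^i$ is the $i$th directional derivative of $f$ at $x$ along $h$; the norm of a symmetric $p$-linear form $A$ is $\|A\|=\max\{|A[h_1,\ldots,h_p]|:\|h_i\|\le1\}$. $H_{f,p}(\nu)=\sup_{x\ne y}\|D^pf(x)-D^pf(y)\|/\|x-y\|^\nu$. $\Phi_{x,p}(y)=f(x)+\sum_{i=1}^p\frac{1}{i!}D^if(x)[y-x]^i$ and $\Omega^{(\alpha)}_{x,p,H}(y)=\Phi_{x,p}(y)+\frac{H}{p!}\|y-x\|^{p+\alpha}$,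 $\alpha\in[0,1]$. **Algorithm 1** (with $\alpha=\nu$ if $\nu$ is known, $\alpha=1$ if $\nu$ is unknown). Step 0: choose $x_0\in\mathbb{E}$, $H_0>0$, $\theta\ge0$, $\epsilon\in(0,1)$; set $t:=0$. Step 1: if $\|\nabla f(x_t)\|_*\le\epsilon$, stop. Step 2: set $i:=0$. Step 2.1: compute an approximate solution $x_{t,i}^+$ of $\min_{y\in\mathbb{E}}\Omega^{(\alpha)}_{x_t,p,2^iH_t}(y)$ such that $$\Omega^{(\alpha)}_{x_t,p,2^iH_t}(x_{t,i}^+)\le f(x_t)\quad\text{and}\quad\|\nabla\Omega^{(\alpha)}_{x_t,p,2^iH_t}(x_{t,i}^+)\|_*\le\theta\|x_{t,i}^+-x_t\|^{p+\alpha-1}.$$ Step 2.2: if either $\|\nabla f(x_{t,i}^+)\|_*\le\epsilon$ or $$f(x_t)-f(x_{t,i}^+)\ge\frac{1}{8(p+1)!(2^iH_t)^{\frac{1}{p+\alpha-1}}}\|\nabla f(x_{t,i}^+)\|_*^{\frac{p+\alpha}{p+\alpha-1}},$$ set $i_t:=i$ and go to Step 3; otherwise set $i:=i+1$ and go to Step 2.1. Step 3: set $x_{t+1}=x_{t,i_t}^+$ and $H_{t+1}=2^{i_t-1}H_t$. Step 4: set $t:=t+1$ and go to Step 1. *)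

theory Defs
  imports "HOL-Analysis.Analysis"
begin

text \<open>
  The finite-dimensional space is a carrier \<open>E = span b\<close>, \<open>b\<close> finite, inside an ambient normed
  space, rather than a type: in this way a constant can be quantified before the space and its
  dimension. The norm and topology of the ambient type only serve to speak about differentiability
  on \<open>E\<close>, where all norms are equivalent.
  Elements of the dual of \<open>E\<close> are functions \<open>'a \<Rightarrow> real\<close>, of which only the values on \<open>E\<close> matter,
  and \<open>B x y\<close> stands for the pairing of \<open>B x\<close> with \<open>y\<close>.
\<close>

definition finite_dim_space :: "'a::real_vector set \<Rightarrow> bool" where
  "finite_dim_space E \<longleftrightarrow> (\<exists>b. finite b \<and> E = span b)"

definition linear_functional_on :: "'a::real_vector set \<Rightarrow> ('a \<Rightarrow> real) \<Rightarrow> bool" where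
  "linear_functional_on E s \<longleftrightarrow>
     (\<forall>x\<in>E. \<forall>y\<in>E. s (x + y) = s x + s y) \<and> (\<forall>c. \<forall>x\<in>E. s (c *\<^sub>R x) = c * s x)"

definition self_adjoint_pos_def_on :: "'a::real_vector set \<Rightarrow> ('a \<Rightarrow> 'a \<Rightarrow> real) \<Rightarrow> bool" where
  "self_adjoint_pos_def_on E B \<longleftrightarrow>
     (\<forall>x\<in>E. linear_functional_on E (B x)) \<and>
     (\<forall>y\<in>E. linear_functional_on E (\<lambda>x. B x y)) \<and>
     (\<forall>x\<in>E. \<forall>y\<in>E. B x y = B y x) \<and>
     (\<forall>x\<in>E. x \<noteq> 0 \<longrightarrow> B x x > 0)"

definition primal_norm :: "('a \<Rightarrow> 'a \<Rightarrow> real) \<Rightarrow> 'a \<Rightarrow> real" where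
  "primal_norm B x = sqrt (B x x)"

definition B_inverse :: "'a set \<Rightarrow> ('a \<Rightarrow> 'a \<Rightarrow> real) \<Rightarrow> ('a \<Rightarrow> real) \<Rightarrow> 'a" where
  "B_inverse E B s = (THE v. v \<in> E \<and> (\<forall>h\<in>E. B v h = s h))"

definition dual_norm :: "'a set \<Rightarrow> ('a \<Rightarrow> 'a \<Rightarrow> real) \<Rightarrow> ('a \<Rightarrow> real) \<Rightarrow> real" where
  "dual_norm E B s = sqrt (s (B_inverse E B s))"

text \<open>
  \<open>nth_deriv f [h\<^sub>1, \<dots>, h\<^sub>i] x\<close> is the value of the \<open>i\<close>-th derivative of \<open>f\<close> at \<open>x\<close> on
  \<open>h\<^sub>1, \<dots>, h\<^sub>i\<close>, obtained by differentiating successively in these directions.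
\<close>

primrec nth_deriv :: "('a::real_vector \<Rightarrow> real) \<Rightarrow> 'a list \<Rightarrow> 'a \<Rightarrow> real" where
  "nth_deriv f [] x = f x"
| "nth_deriv f (h # hs) x = deriv (\<lambda>t::real. nth_deriv f hs (x + t *\<^sub>R h)) 0"

definition gradient :: "('a::real_vector \<Rightarrow> real) \<Rightarrow> 'a \<Rightarrow> 'a \<Rightarrow> real" where
  "gradient f x = (\<lambda>h. nth_deriv f [h] x)"

text \<open>
  As \<open>E\<close> has finite dimension, Frechet differentiability of a map into the \<open>i\<close>-linear forms on \<open>E\<close>
  is Frechet differentiability of each of its evaluations.
\<close>

definition times_differentiable_on ::
    "nat \<Rightarrow> ('a::real_normed_vector \<Rightarrow> real) \<Rightarrow> 'a set \<Rightarrow> bool" where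
  "times_differentiable_on p f E \<longleftrightarrow>
     (\<forall>hs. length hs < p \<and> set hs \<subseteq> E \<longrightarrow> nth_deriv f hs differentiable_on E)"

text \<open>The set is bounded when \<open>A\<close> is a \<open>p\<close>-linear form on the finite-dimensional space \<open>E\<close>.\<close>

definition form_norm ::
    "'a set \<Rightarrow> ('a \<Rightarrow> 'a \<Rightarrow> real) \<Rightarrow> nat \<Rightarrow> ('a list \<Rightarrow> real) \<Rightarrow> real" where
  "form_norm E B p A =
     (SUP hs\<in>{hs. length hs = p \<and> (\<forall>h\<in>set hs. h \<in> E \<and> primal_norm B h \<le> 1)}. \<bar>A hs\<bar>)"

definition holder_const ::
    "'a::real_vector set \<Rightarrow> ('a \<Rightarrow> 'a \<Rightarrow> real) \<Rightarrow> ('a \<Rightarrow> real) \<Rightarrow> nat \<Rightarrow> real \<Rightarrow> ennreal" where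
  "holder_const E B f p \<nu> =
     (SUP (x, y)\<in>{(x, y). x \<in> E \<and> y \<in> E \<and> x \<noteq> y}.
        ennreal (form_norm E B p (\<lambda>hs. nth_deriv f hs x - nth_deriv f hs y)
                 / primal_norm B (x - y) powr \<nu>))"

definition taylor_model ::
    "('a::real_vector \<Rightarrow> real) \<Rightarrow> nat \<Rightarrow> 'a \<Rightarrow> 'a \<Rightarrow> real" where
  "taylor_model f p x y =
     f x + (\<Sum>i=1..p. 1 / fact i * nth_deriv f (replicate i (y - x)) x)"

definition reg_model ::
    "('a::real_vector \<Rightarrow> 'a \<Rightarrow> real) \<Rightarrow> ('a \<Rightarrow> real) \<Rightarrow> nat \<Rightarrow> real \<Rightarrow> real \<Rightarrow> 'a \<Rightarrow> 'a \<Rightarrow> real" where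
  "reg_model B f p \<alpha> M x y =
     taylor_model f p x y + M / fact p * primal_norm B (y - x) powr (real p + \<alpha>)"

definition approx_solution ::
    "'a::real_vector set \<Rightarrow> ('a \<Rightarrow> 'a \<Rightarrow> real) \<Rightarrow> ('a \<Rightarrow> real) \<Rightarrow> nat \<Rightarrow> real \<Rightarrow> real \<Rightarrow> real \<Rightarrow>
      'a \<Rightarrow> 'a \<Rightarrow> bool" where
  "approx_solution E B f p \<alpha> \<theta> M x y \<longleftrightarrow>
     y \<in> E \<and>
     reg_model B f p \<alpha> M x y \<le> f x \<and>
     dual_norm E B (gradient (reg_model B f p \<alpha> M x) y)
       \<le> \<theta> * primal_norm B (y - x) powr (real p + \<alpha> - 1)"

definition accepted ::
    "'a::real_vector set \<Rightarrow> ('a \<Rightarrow> 'a \<Rightarrow> real) \<Rightarrow> ('a \<Rightarrow> real) \<Rightarrow> nat \<Rightarrow> real \<Rightarrow> real \<Rightarrow> real \<Rightarrow>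
      'a \<Rightarrow> 'a \<Rightarrow> bool" where
  "accepted E B f p \<alpha> \<epsilon> M x y \<longleftrightarrow>
     dual_norm E B (gradient f y) \<le> \<epsilon> \<or>
     f x - f y \<ge> 1 / (8 * fact (p + 1) * M powr (1 / (real p + \<alpha> - 1)))
                  * dual_norm E B (gradient f y) powr ((real p + \<alpha>) / (real p + \<alpha> - 1))"

text \<open>
  \<open>x 0, \<dots>, x T\<close> are iterates of the tensor method: \<open>H t\<close> are the regularization parameters,
  \<open>xp t j\<close> the trial points, and \<open>i t\<close> the index of the first accepted trial point.
\<close>

definition tensor_method_iterates ::
    "'a::real_vector set \<Rightarrow> ('a \<Rightarrow> 'a \<Rightarrow> real) \<Rightarrow> ('a \<Rightarrow> real) \<Rightarrow> nat \<Rightarrow> real \<Rightarrow> real \<Rightarrow> real \<Rightarrow> real \<Rightarrow>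
      nat \<Rightarrow> (nat \<Rightarrow> 'a) \<Rightarrow> bool" where
  "tensor_method_iterates E B f p \<alpha> \<theta> \<epsilon> H\<^sub>0 T x \<longleftrightarrow>
     x 0 \<in> E \<and>
     (\<exists>(H :: nat \<Rightarrow> real) (i :: nat \<Rightarrow> nat) (xp :: nat \<Rightarrow> nat \<Rightarrow> 'a).
        H 0 = H\<^sub>0 \<and>
        (\<forall>t<T.
           \<not> dual_norm E B (gradient f (x t)) \<le> \<epsilon> \<and>
           (\<forall>j\<le>i t. approx_solution E B f p \<alpha> \<theta> (2 ^ j * H t) (x t) (xp t j)) \<and>
           (\<forall>j<i t. \<not> accepted E B f p \<alpha> \<epsilon> (2 ^ j * H t) (x t) (xp t j)) \<and>
           accepted E B f p \<alpha> \<epsilon> (2 ^ i t * H t) (x t) (xp t (i t)) \<and>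
           x (Suc t) = xp t (i t) \<and>
           H (Suc t) = 2 powi (int (i t) - 1) * H t))"

end

theory Submission
  imports Defs
begin

text \<open>
  The Hoelder bound on the \<open>p\<close>-th derivative gives Taylor estimates with Lagrange remainder along
  the segment from \<open>x\<close> to \<open>x + u\<close>: the model misses \<open>f\<close> by at most \<open>H r\<^sup>p\<^sup>+\<^sup>\<nu> / p!\<close> and the gradient by
  at most \<open>H r\<^sup>p\<^sup>+\<^sup>\<nu>\<^sup>-\<^sup>1 / (p - 1)!\<close>, where \<open>r\<close> is the length of \<open>u\<close> (lemmas \<open>taylor_model_error\<close>,
  \<open>gradient_norm_bound\<close>). Identifying the gradient of the model with the Taylor polynomial of the
  gradient needs the symmetry of the derivatives of order up to \<open>p\<close>, which holds under mere Frechet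
  differentiability of the derivatives of lower order (\<open>second_difference_tendsto\<close>).

  The heart of the argument is \<open>rejected_parameter_bound\<close>. For a trial point at distance \<open>r\<close>, computed
  with parameter \<open>M \<ge> \<theta>\<close>, the regularization dominates the Taylor errors once
  \<open>M r\<^sup>\<alpha>\<^sup>-\<^sup>\<nu> \<ge> 2 H\<close>; then \<open>f\<close> decreases by at least a multiple of \<open>M r\<^sup>p\<^sup>+\<^sup>\<alpha>\<close>, while the new gradient is at
  most a multiple of \<open>M r\<^sup>p\<^sup>+\<^sup>\<alpha>\<^sup>-\<^sup>1\<close>, and eliminating \<open>r\<close> yields the acceptance test. A rejected trial
  point with \<open>M \<ge> \<theta>\<close> therefore has \<open>M r\<^sup>\<alpha>\<^sup>-\<^sup>\<nu> < 2 H\<close>. As its gradient still exceeds \<open>\<epsilon>\<close>, \<open>r\<close> cannot be too small,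
  and \<open>M\<close> is at most a constant times \<open>\<epsilon>\<close> to the power \<open>- (\<alpha> - \<nu>) / (p + \<nu> - 1)\<close>. For \<open>\<alpha> = \<nu>\<close> this is a
  constant; for \<open>\<alpha> = 1\<close> it is the price of not knowing \<open>\<nu>\<close>.

  Backtracking overshoots the largest rejected parameter by a factor of at most 2, so, up to terms in
  \<open>H\<^sub>0\<close> and \<open>\<theta>\<close>, all accepted parameters obey the same bound. Inserted into the acceptance test, the two powers of \<open>\<epsilon>\<close> combine,
  for every \<open>\<alpha>\<close>, to a decrease of \<open>f\<close> per iteration by a multiple of \<open>\<epsilon>\<close> to the power
  \<open>(p + \<nu>) / (p + \<nu> - 1)\<close>. Summing these decreases against \<open>f (x 0) - fstar\<close> gives the theorem.
\<close>

section \<open>Geometry of the pairing\<close>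

locale pos_def_space =
  fixes E :: "'a::real_normed_vector set" and B :: "'a \<Rightarrow> 'a \<Rightarrow> real"
  assumes finite_dim: "finite_dim_space E"
    and pos_def: "self_adjoint_pos_def_on E B"
begin

abbreviation nrm :: "'a \<Rightarrow> real" where "nrm \<equiv> primal_norm B"

lemma subspace_E: "subspace E"
  using finite_dim unfolding finite_dim_space_def by auto

lemmas E_intros [simp, intro] =
  subspace_0[OF subspace_E] subspace_add[OF subspace_E] subspace_diff[OF subspace_E]
  subspace_scale[OF subspace_E] subspace_sum[OF subspace_E]

lemma B_add_left: "\<lbrakk>x \<in> E; y \<in> E; z \<in> E\<rbrakk> \<Longrightarrow> B (x + y) z = B x z + B y z"
  and B_add_right: "\<lbrakk>x \<in> E; y \<in> E; z \<in> E\<rbrakk> \<Longrightarrow> B z (x + y) = B z x + B z y"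
  and B_scale_left: "\<lbrakk>x \<in> E; z \<in> E\<rbrakk> \<Longrightarrow> B (c *\<^sub>R x) z = c * B x z"
  and B_scale_right: "\<lbrakk>x \<in> E; z \<in> E\<rbrakk> \<Longrightarrow> B z (c *\<^sub>R x) = c * B z x"
  and B_sym: "\<lbrakk>x \<in> E; z \<in> E\<rbrakk> \<Longrightarrow> B x z = B z x"
  and B_pos: "\<lbrakk>x \<in> E; x \<noteq> 0\<rbrakk> \<Longrightarrow> B x x > 0"
  using pos_def unfolding self_adjoint_pos_def_on_def linear_functional_on_def by auto

lemma B_zero [simp]: "z \<in> E \<Longrightarrow> B 0 z = 0" "z \<in> E \<Longrightarrow> B z 0 = 0"
  using B_scale_left[of 0 z 0] B_scale_right[of 0 z 0] by auto

lemma B_diff_left: "\<lbrakk>x \<in> E; y \<in> E; z \<in> E\<rbrakk> \<Longrightarrow> B (x - y) z = B x z - B y z"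
  using B_add_left[of x "(-1) *\<^sub>R y" z] B_scale_left[of y z "-1"] E_intros(4)[of y "-1"] by simp

lemma B_sum_left:
  assumes "\<And>i. i \<in> I \<Longrightarrow> g i \<in> E" "z \<in> E"
  shows "B (\<Sum>i\<in>I. g i) z = (\<Sum>i\<in>I. B (g i) z)"
  using assms(1)
proof (induction I rule: infinite_finite_induct)
  case (insert i I)
  have "(\<Sum>i\<in>I. g i) \<in> E" using insert by auto
  then show ?case using insert assms(2) by (simp add: B_add_left)
qed (use assms in auto)

lemma B_nonneg: "x \<in> E \<Longrightarrow> 0 \<le> B x x"
  using B_pos[of x] by (cases "x = 0") auto

lemma nrm_sq: "x \<in> E \<Longrightarrow> nrm x ^ 2 = B x x"
  by (simp add: primal_norm_def B_nonneg)

lemma nrm_nonneg: "x \<in> E \<Longrightarrow> 0 \<le> nrm x"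
  by (simp add: primal_norm_def B_nonneg)

lemma nrm_pos: "\<lbrakk>x \<in> E; x \<noteq> 0\<rbrakk> \<Longrightarrow> 0 < nrm x"
  by (simp add: primal_norm_def B_pos)

lemma nrm_zero [simp]: "nrm 0 = 0"
  by (simp add: primal_norm_def)

lemma nrm_scale: "x \<in> E \<Longrightarrow> nrm (c *\<^sub>R x) = \<bar>c\<bar> * nrm x"
  by (simp add: primal_norm_def B_scale_left B_scale_right real_sqrt_mult[symmetric] mult.assoc[symmetric])
     (simp add: real_sqrt_mult)

lemma quadratic_expand:
  assumes "x \<in> E" "h \<in> E"
  shows "B (x + t *\<^sub>R h) (x + t *\<^sub>R h) = B x x + 2 * t * B x h + t\<^sup>2 * B h h"
  using assms B_sym[of h x]
  by (simp add: B_add_left B_add_right B_scale_left B_scale_right power2_eq_square algebra_simps)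

lemma Cauchy_Schwarz:
  assumes "x \<in> E" "h \<in> E"
  shows "\<bar>B x h\<bar> \<le> nrm x * nrm h"
proof (cases "h = 0")
  case False
  then have p: "B h h > 0" using assms B_pos by auto
  have "0 \<le> B (x + (- B x h / B h h) *\<^sub>R h) (x + (- B x h / B h h) *\<^sub>R h)"
    using assms by (intro B_nonneg) auto
  then have "0 \<le> B x x - (B x h)\<^sup>2 / B h h"
    using p by (subst (asm) quadratic_expand[OF assms]) (simp add: power2_eq_square field_simps)
  then have "(B x h)\<^sup>2 \<le> B x x * B h h" using p by (simp add: field_simps)
  then have "sqrt ((B x h)\<^sup>2) \<le> sqrt (B x x * B h h)" by (rule real_sqrt_le_mono)
  then show ?thesis by (simp add: primal_norm_def real_sqrt_mult)
qed (use assms in auto)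

definition orthonormal_basis :: "'a set \<Rightarrow> 'a set \<Rightarrow> bool" where
  "orthonormal_basis S Q \<longleftrightarrow> finite Q \<and> Q \<subseteq> S \<and>
     (\<forall>e\<in>Q. \<forall>e'\<in>Q. B e e' = (if e = e' then 1 else 0)) \<and>
     (\<forall>h\<in>S. h = (\<Sum>e\<in>Q. B h e *\<^sub>R e))"

text \<open>
  Gram-Schmidt: removing from the new vector \<open>a\<close> its components along the orthonormal basis found so
  far leaves a vector \<open>c\<close> that either vanishes, so that the span did not grow, or can be normalized
  and added.
\<close>

lemma orthonormal_basis_exists_span:
  assumes "finite b" "b \<subseteq> E"
  shows "\<exists>Q. orthonormal_basis (span b) Q"
  using assms
proof (induction b)
  case empty
  show ?case by (rule exI[of _ "{}"]) (auto simp: orthonormal_basis_def)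
next
  case (insert a b)
  then obtain Q where "orthonormal_basis (span b) Q" by auto
  then have Q: "finite Q" "Q \<subseteq> span b"
      "\<And>e e'. \<lbrakk>e \<in> Q; e' \<in> Q\<rbrakk> \<Longrightarrow> B e e' = (if e = e' then 1 else 0)"
      "\<And>h. h \<in> span b \<Longrightarrow> h = (\<Sum>e\<in>Q. B h e *\<^sub>R e)"
    unfolding orthonormal_basis_def by blast+
  have sE: "span b \<subseteq> E" using insert subspace_E by (simp add: span_minimal)
  have QE: "e \<in> E" if "e \<in> Q" for e using that Q(2) sE by auto
  have aE: "a \<in> E" using insert by simp
  define c where "c = a - (\<Sum>e\<in>Q. B a e *\<^sub>R e)"
  have cE: "c \<in> E" unfolding c_def using aE QE by auto
  have ort: "B c e = 0" if e: "e \<in> Q" for e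
  proof -
    have "B (\<Sum>e\<in>Q. B a e *\<^sub>R e) e = (\<Sum>e'\<in>Q. B (B a e' *\<^sub>R e') e)"
      using QE e by (intro B_sum_left) auto
    also have "\<dots> = (\<Sum>e'\<in>Q. if e' = e then B a e else 0)"
      using QE e Q(3) by (intro sum.cong) (auto simp: B_scale_left)
    also have "\<dots> = B a e" using e Q(1) by simp
    finally show ?thesis unfolding c_def using aE QE e by (subst B_diff_left) auto
  qed
  have proj: "(\<Sum>e\<in>Q. B a e *\<^sub>R e) \<in> span b"
    using Q(2) by (intro span_sum span_scale) auto
  show ?case
  proof (cases "c = 0")
    case True
    then have "a \<in> span b" using proj by (simp add: c_def)
    then have "span (insert a b) = span b" by (rule span_redundant)
    moreover have "orthonormal_basis (span b) Q" unfolding orthonormal_basis_def using Q by blast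
    ultimately show ?thesis by auto
  next
    case False
    define w where "w = (1 / nrm c) *\<^sub>R c"
    have np: "nrm c > 0" using False cE nrm_pos by auto
    have wE: "w \<in> E" using cE by (simp add: w_def)
    have ww: "B w w = 1"
      using cE np nrm_sq[OF cE, symmetric]
      by (simp add: w_def B_scale_left B_scale_right power2_eq_square)
    have we: "B w e = 0" "B e w = 0" if "e \<in> Q" for e
      using that cE QE ort B_sym[of e w] wE by (auto simp: w_def B_scale_left)
    have wQ: "w \<notin> Q" using ww we(1)[of w] by auto
    have wspan: "w \<in> span (insert a b)"
      unfolding w_def c_def using proj span_mono[of b "insert a b"]
      by (intro span_scale span_diff) (auto intro: span_base)
    have rep: "h = (\<Sum>e\<in>insert w Q. B h e *\<^sub>R e)" if "h \<in> span (insert a b)" for h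
    proof -
      obtain k where k: "h - k *\<^sub>R a \<in> span b" using \<open>h \<in> _\<close> by (auto simp: span_breakdown_eq)
      define v where "v = h - (k * nrm c) *\<^sub>R w"
      have "v = (h - k *\<^sub>R a) + k *\<^sub>R (\<Sum>e\<in>Q. B a e *\<^sub>R e)"
        using np by (simp add: v_def w_def c_def algebra_simps)
      then have vs: "v \<in> span b" using k proj by (auto intro: span_add span_scale)
      then have vE: "v \<in> E" using sE by auto
      have hv: "h = v + (k * nrm c) *\<^sub>R w" by (simp add: v_def)
      have veq: "v = (\<Sum>e\<in>Q. B v e *\<^sub>R e)" using Q(4) vs by blast
      have "B v w = B (\<Sum>e\<in>Q. B v e *\<^sub>R e) w" by (rule arg_cong[OF veq, of "\<lambda>v. B v w"])
      also have "\<dots> = (\<Sum>e\<in>Q. B (B v e *\<^sub>R e) w)" using QE wE by (intro B_sum_left) auto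
      also have "\<dots> = 0" using QE wE we by (intro sum.neutral) (auto simp: B_scale_left)
      finally have vw: "B v w = 0" .
      have "B h w = k * nrm c"
        unfolding hv using vE wE vw ww by (simp add: B_add_left B_scale_left)
      moreover have "B h e = B v e" if "e \<in> Q" for e
        unfolding hv using vE wE QE that we by (simp add: B_add_left B_scale_left)
      then have "(\<Sum>e\<in>Q. B h e *\<^sub>R e) = v" by (subst veq) (rule sum.cong, auto)
      ultimately have "(\<Sum>e\<in>insert w Q. B h e *\<^sub>R e) = (k * nrm c) *\<^sub>R w + v" using Q(1) wQ by simp
      then show ?thesis by (subst hv) (simp only: add.commute)
    qed
    show ?thesis
    proof (intro exI[of _ "insert w Q"], unfold orthonormal_basis_def, intro conjI ballI)
      show "insert w Q \<subseteq> span (insert a b)"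
        using wspan Q(2) span_mono[of b "insert a b"] by auto
    next
      fix e e' assume "e \<in> insert w Q" "e' \<in> insert w Q"
      then show "B e e' = (if e = e' then 1 else 0)" using Q(3) ww we wQ by auto
    next
      fix h assume "h \<in> span (insert a b)"
      then show "h = (\<Sum>e\<in>insert w Q. B h e *\<^sub>R e)" by (rule rep)
    qed (use Q(1) in simp)
  qed
qed

lemma orthonormal_basis_exists: "\<exists>Q. orthonormal_basis E Q"
  using finite_dim orthonormal_basis_exists_span span_superset
  unfolding finite_dim_space_def by metis

lemma linear_functional_sum:
  assumes s: "linear_functional_on E s" and "\<And>i. i \<in> I \<Longrightarrow> g i \<in> E"
  shows "s (\<Sum>i\<in>I. c i *\<^sub>R g i) = (\<Sum>i\<in>I. c i * s (g i))"
proof -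
  have z: "s 0 = 0"
    using s E_intros(1) unfolding linear_functional_on_def by (metis mult_zero_left scale_zero_left)
  show ?thesis
    using assms(2)
  proof (induction I rule: infinite_finite_induct)
    case (insert i I)
    have "(\<Sum>i\<in>I. c i *\<^sub>R g i) \<in> E" using insert by auto
    then show ?case using insert s unfolding linear_functional_on_def by simp
  qed (use z in auto)
qed

text \<open>
  This makes the definite description in \<open>B_inverse\<close> meaningful, so that \<open>dual_norm\<close> of a functional
  becomes the norm of its representing vector and is the operator norm (the lemmas below).
\<close>

lemma riesz:
  assumes s: "linear_functional_on E s"
  shows "\<exists>!v. v \<in> E \<and> (\<forall>h\<in>E. B v h = s h)"
proof (rule ex_ex1I)
  obtain Q where "orthonormal_basis E Q" using orthonormal_basis_exists by blast
  then have Q: "finite Q" "\<And>e. e \<in> Q \<Longrightarrow> e \<in> E" "\<And>h. h \<in> E \<Longrightarrow> h = (\<Sum>e\<in>Q. B h e *\<^sub>R e)"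
    unfolding orthonormal_basis_def by blast+
  define v where "v = (\<Sum>e\<in>Q. s e *\<^sub>R e)"
  have "v \<in> E" unfolding v_def using Q(2) by auto
  moreover have "B v h = s h" if h: "h \<in> E" for h
  proof -
    have "B v h = (\<Sum>e\<in>Q. B (s e *\<^sub>R e) h)"
      unfolding v_def using Q(2) h by (intro B_sum_left) auto
    also have "\<dots> = (\<Sum>e\<in>Q. B h e * s e)"
      using Q(2) h by (intro sum.cong) (auto simp: B_scale_left B_scale_right B_sym[of _ h])
    also have "\<dots> = s (\<Sum>e\<in>Q. B h e *\<^sub>R e)"
      using Q(2) by (intro linear_functional_sum[OF s, symmetric]) auto
    also have "\<dots> = s h" by (rule arg_cong[OF Q(3)[OF h, symmetric]])
    finally show ?thesis .
  qed
  ultimately show "\<exists>v. v \<in> E \<and> (\<forall>h\<in>E. B v h = s h)" by blast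
next
  fix v w assume vw: "v \<in> E \<and> (\<forall>h\<in>E. B v h = s h)" "w \<in> E \<and> (\<forall>h\<in>E. B w h = s h)"
  then have "B (v - w) (v - w) = 0" by (simp add: B_diff_left)
  then show "v = w" using B_pos[of "v - w"] vw by force
qed

lemma B_inverse_props:
  assumes s: "linear_functional_on E s"
  shows "B_inverse E B s \<in> E" "\<And>h. h \<in> E \<Longrightarrow> B (B_inverse E B s) h = s h"
  using theI'[OF riesz[OF s]] unfolding B_inverse_def by auto

lemma dual_norm_eq:
  assumes s: "linear_functional_on E s"
  shows "dual_norm E B s = nrm (B_inverse E B s)"
  using B_inverse_props[OF s] by (simp add: dual_norm_def primal_norm_def)

lemma dual_norm_bound:
  assumes s: "linear_functional_on E s" and "h \<in> E"
  shows "\<bar>s h\<bar> \<le> dual_norm E B s * nrm h"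
  using Cauchy_Schwarz B_inverse_props[OF s] dual_norm_eq[OF s] assms by metis

lemma dual_norm_le:
  assumes s: "linear_functional_on E s" and c: "0 \<le> c" and bd: "\<And>h. h \<in> E \<Longrightarrow> \<bar>s h\<bar> \<le> c * nrm h"
  shows "dual_norm E B s \<le> c"
proof -
  define v where "v = B_inverse E B s"
  have v: "v \<in> E" "s v = nrm v ^ 2"
    using B_inverse_props[OF s] nrm_sq by (auto simp: v_def)
  have "nrm v * nrm v \<le> c * nrm v" using bd[OF v(1)] v(2) by (simp add: power2_eq_square)
  then have "nrm v \<le> c" using nrm_nonneg[OF v(1)] c by (cases "nrm v = 0") auto
  then show ?thesis by (simp add: dual_norm_eq[OF s] v_def)
qed

end

text \<open>
  Unfolded, a multilinear form becomes the derivative of a function on the real line, which the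
  rules of multilinearity and symmetry do not match.
\<close>

declare nth_deriv.simps(2) [simp del]

section \<open>Symmetry and multilinearity of higher derivatives\<close>

locale smooth_on_subspace =
  fixes E :: "'a::real_normed_vector set" and f :: "'a \<Rightarrow> real" and p :: nat
  assumes is_subspace: "subspace E"
    and smooth: "times_differentiable_on p f E"
begin

lemma line_in_E: "\<lbrakk>x \<in> E; h \<in> E\<rbrakk> \<Longrightarrow> x + t *\<^sub>R h \<in> E"
  using is_subspace by (simp add: subspace_add subspace_scale)

text \<open>
  Derivatives are taken within the subspace, which a line through a point of it never leaves; so
  Frechet derivatives in this sense restrict to ordinary derivatives on the real line.
\<close>

lemma has_derivative_along_line:
  assumes g: "(g has_derivative L) (at (x + s *\<^sub>R h) within E)" and "x \<in> E" "h \<in> E"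
  shows "((\<lambda>t. g (x + t *\<^sub>R h)) has_real_derivative L h) (at s)"
proof -
  have "((\<lambda>t. x + t *\<^sub>R h) has_derivative (\<lambda>t. t *\<^sub>R h)) (at s)"
    by (auto intro!: derivative_eq_intros)
  moreover have "(g has_derivative L) (at (x + s *\<^sub>R h) within range (\<lambda>t. x + t *\<^sub>R h))"
    using line_in_E assms by (intro has_derivative_subset[OF g]) auto
  ultimately have "((\<lambda>t. g (x + t *\<^sub>R h)) has_derivative (\<lambda>t. L (t *\<^sub>R h))) (at s)"
    by (rule has_derivative_in_compose)
  moreover have "(\<lambda>t. L (t *\<^sub>R h)) = (*) (L h)"
    using g by (auto simp: linear_scale has_derivative_linear mult.commute)
  ultimately show ?thesis by (simp add: has_field_derivative_def)
qed

lemma nth_deriv_frechet: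
  assumes "length hs < p" "set hs \<subseteq> E" "x \<in> E"
  obtains L where "(nth_deriv f hs has_derivative L) (at x within E)"
    "\<And>h. h \<in> E \<Longrightarrow> nth_deriv f (h # hs) x = L h"
proof -
  obtain L where L: "(nth_deriv f hs has_derivative L) (at x within E)"
    using smooth assms unfolding times_differentiable_on_def differentiable_on_def differentiable_def
    by blast
  moreover have "nth_deriv f (h # hs) x = L h" if "h \<in> E" for h
    using has_derivative_along_line[of "nth_deriv f hs" L x 0 h] L assms that
    by (simp add: nth_deriv.simps(2) DERIV_imp_deriv)
  ultimately show ?thesis using that by blast
qed

lemma nth_deriv_along_line:
  assumes "length hs < p" "set hs \<subseteq> E" "x \<in> E" "h \<in> E"
  shows "((\<lambda>t. nth_deriv f hs (x + t *\<^sub>R h)) has_real_derivative nth_deriv f (h # hs) (x + s *\<^sub>R h)) (at s)"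
proof -
  obtain L where L: "(nth_deriv f hs has_derivative L) (at (x + s *\<^sub>R h) within E)"
    "\<And>k. k \<in> E \<Longrightarrow> nth_deriv f (k # hs) (x + s *\<^sub>R h) = L k"
    using nth_deriv_frechet[of hs "x + s *\<^sub>R h"] assms line_in_E by metis
  show ?thesis using has_derivative_along_line[OF L(1)] L(2) assms by metis
qed

lemma nth_deriv_head_linear:
  assumes "length hs < p" "set hs \<subseteq> E" "x \<in> E"
  shows "\<exists>L. linear L \<and> (\<forall>h\<in>E. nth_deriv f (h # hs) x = L h)"
  using nth_deriv_frechet[OF assms] has_derivative_linear by metis

lemma nth_deriv_head_add_scaled:
  assumes "length hs < p" "set hs \<subseteq> E" "x \<in> E" "h \<in> E" "k \<in> E"
  shows "nth_deriv f ((h + c *\<^sub>R k) # hs) x = nth_deriv f (h # hs) x + c * nth_deriv f (k # hs) x"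
proof -
  obtain L where "linear L" "\<forall>h\<in>E. nth_deriv f (h # hs) x = L h"
    using nth_deriv_head_linear assms by blast
  then show ?thesis using assms line_in_E[of h k c] by (simp add: linear_add linear_scale)
qed

lemma nth_deriv_head_scale:
  assumes "length hs < p" "set hs \<subseteq> E" "x \<in> E" "h \<in> E"
  shows "nth_deriv f ((c *\<^sub>R h) # hs) x = c * nth_deriv f (h # hs) x"
proof -
  obtain L where "linear L" "\<forall>h\<in>E. nth_deriv f (h # hs) x = L h"
    using nth_deriv_head_linear assms by blast
  then show ?thesis using assms is_subspace by (simp add: linear_scale subspace_scale)
qed

lemma nth_deriv_head_sum:
  assumes "length hs < p" "set hs \<subseteq> E" "x \<in> E" and Q: "Q \<subseteq> E"
  shows "nth_deriv f ((\<Sum>e\<in>Q. c e *\<^sub>R e) # hs) x = (\<Sum>e\<in>Q. c e * nth_deriv f (e # hs) x)"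
proof -
  obtain L where L: "linear L" "\<forall>h\<in>E. nth_deriv f (h # hs) x = L h"
    using nth_deriv_head_linear assms by blast
  moreover have "(\<Sum>e\<in>Q. c e *\<^sub>R e) \<in> E"
    using Q is_subspace by (intro subspace_sum subspace_scale) auto
  ultimately show ?thesis
    using Q by (simp add: linear_sum linear_scale) (intro sum.cong, auto)
qed

text \<open>
  A second difference at scale \<open>s\<close> is, by the mean value theorem in the direction \<open>b\<close>, \<open>s\<close> times a
  difference of first derivatives in the direction \<open>b\<close>, which the derivative at \<open>x\<close> alone
  determines up to \<open>o(s)\<close>. So mere differentiability of the derivative suffices, without continuity
  of the second derivative.
\<close>

lemma second_difference_tendsto:
  assumes len: "length hs + 2 \<le> p" and hs: "set hs \<subseteq> E" and x: "x \<in> E" and a: "a \<in> E" and b: "b \<in> E"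
  defines "G \<equiv> nth_deriv f hs"
  shows "((\<lambda>s. (G (x + s *\<^sub>R a + s *\<^sub>R b) - G (x + s *\<^sub>R a) - G (x + s *\<^sub>R b) + G x) / s\<^sup>2)
           \<longlongrightarrow> nth_deriv f (a # b # hs) x) (at_right 0)"
proof (rule tendstoI)
  fix e :: real assume e: "e > 0"
  define k where "k = nth_deriv f (b # hs)"
  define N where "N = norm a + norm b + 1"
  have N: "N > 0" unfolding N_def by (simp add: add_nonneg_pos)
  obtain L where L: "(k has_derivative L) (at x within E)"
      "\<And>h. h \<in> E \<Longrightarrow> nth_deriv f (h # b # hs) x = L h"
    using nth_deriv_frechet[of "b # hs" x] len hs x b unfolding k_def by auto
  have linL: "linear L" using L(1) by (rule has_derivative_linear)
  define e' where "e' = e / (4 * N)"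
  have "e' > 0" using e N by (simp add: e'_def)
  then obtain d where d: "d > 0" and dd: "\<And>z. \<lbrakk>z \<in> E; norm (z - x) < d\<rbrakk> \<Longrightarrow>
      \<bar>k z - k x - L (z - x)\<bar> \<le> e' * norm (z - x)"
    using L(1) unfolding has_derivative_within_alt by (metis real_norm_def)
  have main: "dist ((G (x + s *\<^sub>R a + s *\<^sub>R b) - G (x + s *\<^sub>R a) - G (x + s *\<^sub>R b) + G x) / s\<^sup>2)
                (nth_deriv f (a # b # hs) x) < e"
    if s: "0 < s" "s < d / N" for s
  proof -
    have xa: "x + s *\<^sub>R a \<in> E" using line_in_E x a by auto
    define u where "u = (\<lambda>\<tau>. G (x + s *\<^sub>R a + \<tau> *\<^sub>R b) - G (x + \<tau> *\<^sub>R b))"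
    have "(u has_real_derivative (k (x + s *\<^sub>R a + \<tau> *\<^sub>R b) - k (x + \<tau> *\<^sub>R b))) (at \<tau>)" for \<tau>
      unfolding u_def G_def k_def using len hs x b xa
      by (intro DERIV_diff nth_deriv_along_line) auto
    then obtain \<xi> where \<xi>: "0 < \<xi>" "\<xi> < s"
        "u s - u 0 = (s - 0) * (k (x + s *\<^sub>R a + \<xi> *\<^sub>R b) - k (x + \<xi> *\<^sub>R b))"
      using MVT2[of 0 s u "\<lambda>\<tau>. k (x + s *\<^sub>R a + \<tau> *\<^sub>R b) - k (x + \<tau> *\<^sub>R b)"] s by blast
    have aE: "L (s *\<^sub>R a + \<xi> *\<^sub>R b) = s * L a + \<xi> * L b" "L (\<xi> *\<^sub>R b) = \<xi> * L b"
      using linL by (simp_all add: linear_add linear_scale)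
    have n1: "norm (s *\<^sub>R a + \<xi> *\<^sub>R b) \<le> s * N"
    proof -
      have "norm (s *\<^sub>R a + \<xi> *\<^sub>R b) \<le> s * norm a + \<xi> * norm b"
        using s \<xi> by (intro norm_triangle_le) auto
      also have "\<dots> \<le> s * norm a + s * norm b" using \<xi> by (intro add_left_mono mult_right_mono) auto
      also have "\<dots> \<le> s * N" using s by (simp add: N_def algebra_simps)
      finally show ?thesis .
    qed
    have n2: "norm (\<xi> *\<^sub>R b) \<le> s * N"
    proof -
      have "norm (\<xi> *\<^sub>R b) \<le> s * norm b" using \<xi> by (auto intro: mult_right_mono)
      also have "\<dots> \<le> s * N" using s by (intro mult_left_mono) (auto simp: N_def)
      finally show ?thesis .
    qed
    have sN: "s * N < d" using s N by (simp add: pos_less_divide_eq)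
    have k1: "\<bar>k (x + s *\<^sub>R a + \<xi> *\<^sub>R b) - k x - (s * L a + \<xi> * L b)\<bar> \<le> e' * (s * N)"
    proof -
      have "\<bar>k (x + s *\<^sub>R a + \<xi> *\<^sub>R b) - k x - L (x + s *\<^sub>R a + \<xi> *\<^sub>R b - x)\<bar>
              \<le> e' * norm (x + s *\<^sub>R a + \<xi> *\<^sub>R b - x)"
        using n1 sN line_in_E[OF xa b] by (intro dd) (simp_all add: add.assoc)
      also have "\<dots> \<le> e' * (s * N)" using n1 \<open>e' > 0\<close> by (simp add: add.assoc)
      finally show ?thesis using aE by (simp add: add.assoc)
    qed
    have k2: "\<bar>k (x + \<xi> *\<^sub>R b) - k x - \<xi> * L b\<bar> \<le> e' * (s * N)"
    proof -
      have "\<bar>k (x + \<xi> *\<^sub>R b) - k x - L (x + \<xi> *\<^sub>R b - x)\<bar> \<le> e' * norm (x + \<xi> *\<^sub>R b - x)"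
        using n2 sN x b line_in_E by (intro dd) auto
      also have "\<dots> \<le> e' * (s * N)" using n2 \<open>e' > 0\<close> by simp
      finally show ?thesis using aE by simp
    qed
    define D where "D = k (x + s *\<^sub>R a + \<xi> *\<^sub>R b) - k (x + \<xi> *\<^sub>R b)"
    have Db: "\<bar>D - s * L a\<bar> \<le> e / 2 * s"
    proof -
      have "\<bar>D - s * L a\<bar> \<le> 2 * (e' * (s * N))" unfolding D_def using k1 k2 by linarith
      also have "\<dots> = e / 2 * s" using N by (simp add: e'_def)
      finally show ?thesis .
    qed
    have "(G (x + s *\<^sub>R a + s *\<^sub>R b) - G (x + s *\<^sub>R a) - G (x + s *\<^sub>R b) + G x) = s * D"
      using \<xi>(3) by (simp add: u_def D_def)
    then have "(G (x + s *\<^sub>R a + s *\<^sub>R b) - G (x + s *\<^sub>R a) - G (x + s *\<^sub>R b) + G x) / s\<^sup>2 - L a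
        = (D - s * L a) / s"
      using s by (simp add: power2_eq_square field_simps)
    also have "\<bar>\<dots>\<bar> \<le> e / 2" using Db s by (simp add: pos_divide_le_eq)
    finally show ?thesis using e L(2)[OF a] by (simp add: dist_real_def)
  qed
  have "eventually (\<lambda>s. 0 < s \<and> s < d / N) (at_right 0)"
    using d N by (auto simp: eventually_at_right_field intro!: exI[of _ "d / N"])
  then show "eventually (\<lambda>s. dist ((G (x + s *\<^sub>R a + s *\<^sub>R b) - G (x + s *\<^sub>R a) - G (x + s *\<^sub>R b) + G x) / s\<^sup>2)
                (nth_deriv f (a # b # hs) x) < e) (at_right 0)"
    by (rule eventually_mono) (use main in blast)
qed

lemma nth_deriv_swap_head:
  assumes "length hs + 2 \<le> p" "set hs \<subseteq> E" "x \<in> E" "a \<in> E" "b \<in> E"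
  shows "nth_deriv f (a # b # hs) x = nth_deriv f (b # a # hs) x"
proof -
  let ?G = "nth_deriv f hs"
  have "(\<lambda>s. (?G (x + s *\<^sub>R a + s *\<^sub>R b) - ?G (x + s *\<^sub>R a) - ?G (x + s *\<^sub>R b) + ?G x) / s\<^sup>2)
      = (\<lambda>s. (?G (x + s *\<^sub>R b + s *\<^sub>R a) - ?G (x + s *\<^sub>R b) - ?G (x + s *\<^sub>R a) + ?G x) / s\<^sup>2)"
    by (intro ext) (simp add: algebra_simps)
  then show ?thesis
    using second_difference_tendsto[of hs x a b] second_difference_tendsto[of hs x b a] assms
    by (metis (no_types, lifting) tendsto_unique trivial_limit_at_right_real)
qed

lemma nth_deriv_Cons_cong:
  assumes "\<And>z. z \<in> E \<Longrightarrow> nth_deriv f hs z = nth_deriv f hs' z" "a \<in> E" "x \<in> E"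
  shows "nth_deriv f (a # hs) x = nth_deriv f (a # hs') x"
  using assms line_in_E by (simp add: nth_deriv.simps(2))

text \<open>
  The symmetry of second derivatives concerns the two outermost directions; inner ones can be exchanged
  because the derivatives of equal functions agree.
\<close>

lemma nth_deriv_move_to_head:
  assumes "length (ks @ a # hs) \<le> p" "set (ks @ a # hs) \<subseteq> E" "x \<in> E"
  shows "nth_deriv f (ks @ a # hs) x = nth_deriv f (a # ks @ hs) x"
  using assms
proof (induction ks arbitrary: x)
  case (Cons k ks)
  have "nth_deriv f ((k # ks) @ a # hs) x = nth_deriv f (k # a # ks @ hs) x"
    using Cons by (simp only: append_Cons) (rule nth_deriv_Cons_cong, auto)
  also have "\<dots> = nth_deriv f (a # k # ks @ hs) x"
    using Cons.prems by (intro nth_deriv_swap_head) auto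
  finally show ?case by simp
qed simp

lemma nth_deriv_mset_cong:
  assumes "length hs \<le> p" "set hs \<subseteq> E" "x \<in> E" "mset hs = mset hs'"
  shows "nth_deriv f hs x = nth_deriv f hs' x"
  using assms
proof (induction hs arbitrary: hs' x)
  case (Cons a hs)
  have "a \<in> set hs'" using Cons.prems(4) by (metis list.set_intros(1) set_mset_mset)
  then obtain ks ls where hs': "hs' = ks @ a # ls" by (meson split_list)
  have m: "mset hs = mset (ks @ ls)" using Cons.prems(4) hs' by simp
  then have sets: "set hs = set (ks @ ls)" "length hs = length (ks @ ls)"
    by (metis set_mset_mset, metis size_mset)
  have "nth_deriv f (a # hs) x = nth_deriv f (a # ks @ ls) x"
    using Cons m by (intro nth_deriv_Cons_cong) auto
  also have "\<dots> = nth_deriv f hs' x"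
    unfolding hs' using Cons.prems sets by (intro nth_deriv_move_to_head[symmetric]) auto
  finally show ?case .
qed simp

text \<open>
  This is the rule \<open>d A[u]\<^sup>j = j A[u, ..., u, du]\<close> for a symmetric form \<open>A\<close>. The remaining
  arguments \<open>ks\<close> are carried along so that the induction can split off one factor \<open>u + t h\<close>,
  whose two summands join \<open>ks\<close>.
\<close>

lemma diagonal_form_derivative:
  assumes "j + length ks \<le> p" "set ks \<subseteq> E" "x \<in> E" "u \<in> E" "h \<in> E"
  shows "((\<lambda>t. nth_deriv f (replicate j (u + t *\<^sub>R h) @ ks) x) has_real_derivative
           real j * nth_deriv f (replicate (j - 1) u @ h # ks) x) (at 0)"
  using assms(1,2)
proof (induction j arbitrary: ks)
  case (Suc j)
  have uh: "u + t *\<^sub>R h \<in> E" for t using line_in_E assms by auto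
  have mv: "nth_deriv f (replicate j v @ w # ks) x = nth_deriv f (w # replicate j v @ ks) x"
    if "v \<in> E" "w \<in> E" for v w
    using that Suc.prems assms by (intro nth_deriv_move_to_head) auto
  have "nth_deriv f (replicate (Suc j) (u + t *\<^sub>R h) @ ks) x =
      nth_deriv f (replicate j (u + t *\<^sub>R h) @ u # ks) x
      + t * nth_deriv f (replicate j (u + t *\<^sub>R h) @ h # ks) x" for t
    using Suc.prems assms uh[of t] mv[of "u + t *\<^sub>R h"]
    by (simp) (subst nth_deriv_head_add_scaled, auto)
  moreover have "((\<lambda>t. nth_deriv f (replicate j (u + t *\<^sub>R h) @ u # ks) x
      + t * nth_deriv f (replicate j (u + t *\<^sub>R h) @ h # ks) x) has_real_derivative
       real j * nth_deriv f (replicate (j - 1) u @ h # u # ks) x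
       + (1 * nth_deriv f (replicate j (u + 0 *\<^sub>R h) @ h # ks) x
          + real j * nth_deriv f (replicate (j - 1) u @ h # h # ks) x * 0)) (at 0)"
    using Suc.prems assms by (intro DERIV_add DERIV_mult DERIV_ident Suc.IH) auto
  moreover have "real j * nth_deriv f (replicate (j - 1) u @ h # u # ks) x
      = real j * nth_deriv f (replicate j u @ h # ks) x"
  proof (cases j)
    case (Suc i)
    have "nth_deriv f (replicate i u @ h # u # ks) x = nth_deriv f (replicate (Suc i) u @ h # ks) x"
      using Suc.prems assms \<open>j = Suc i\<close> by (intro nth_deriv_mset_cong) auto
    then show ?thesis using Suc by simp
  qed simp
  ultimately show ?case by (auto simp: algebra_simps)
qed simp

end

section \<open>Taylor bounds\<close>

lemma power_powr_add: "0 \<le> (r::real) \<Longrightarrow> 0 < n \<Longrightarrow> r powr s * r ^ n = r powr (real n + s)"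
  by (cases "r = 0") (auto simp: powr_add powr_realpow)

locale smooth_on_pos_def_space = pos_def_space E B + smooth_on_subspace E f p
  for E :: "'a::real_normed_vector set" and B f p
begin

text \<open>
  Finite dimension enters here: expanding one argument at a time in an orthonormal basis, with
  coordinates of modulus at most 1, reduces the claim to finitely many values. Without such a bound
  the supremum in \<open>form_norm\<close> would carry no information.
\<close>

lemma nth_deriv_bounded_on_unit_ball:
  assumes "x \<in> E" "m + length ts \<le> p" "set ts \<subseteq> E"
  shows "\<exists>K. \<forall>hs. length hs = m \<and> (\<forall>h\<in>set hs. h \<in> E \<and> nrm h \<le> 1) \<longrightarrow> \<bar>nth_deriv f (hs @ ts) x\<bar> \<le> K"
  using assms(2,3)
proof (induction m arbitrary: ts)
  case (Suc m)
  obtain Q where "orthonormal_basis E Q" using orthonormal_basis_exists by blast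
  then have Q: "finite Q" "Q \<subseteq> E" "\<forall>e\<in>Q. \<forall>e'\<in>Q. B e e' = (if e = e' then 1 else 0)"
      "\<And>h. h \<in> E \<Longrightarrow> h = (\<Sum>e\<in>Q. B h e *\<^sub>R e)"
    unfolding orthonormal_basis_def by blast+
  have "\<exists>K. \<forall>hs. length hs = m \<and> (\<forall>h\<in>set hs. h \<in> E \<and> nrm h \<le> 1) \<longrightarrow> \<bar>nth_deriv f (hs @ e # ts) x\<bar> \<le> K"
    if "e \<in> Q" for e
    using that Q(2) Suc.prems by (intro Suc.IH) auto
  then obtain K where K: "\<And>e hs. \<lbrakk>e \<in> Q; length hs = m; \<forall>h\<in>set hs. h \<in> E \<and> nrm h \<le> 1\<rbrakk>
      \<Longrightarrow> \<bar>nth_deriv f (hs @ e # ts) x\<bar> \<le> K e"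
    by metis
  have "\<bar>nth_deriv f (gs @ ts) x\<bar> \<le> (\<Sum>e\<in>Q. K e)"
    if gs: "length gs = Suc m" "\<forall>h\<in>set gs. h \<in> E \<and> nrm h \<le> 1" for gs
  proof -
    obtain h hs where g: "gs = h # hs" using gs(1) by (cases gs) auto
    have h: "h \<in> E" "nrm h \<le> 1" and hs: "length hs = m" "set hs \<subseteq> E" "\<forall>h\<in>set hs. h \<in> E \<and> nrm h \<le> 1"
      using gs g by auto
    have "nth_deriv f (gs @ ts) x = nth_deriv f ((\<Sum>e\<in>Q. B h e *\<^sub>R e) # hs @ ts) x"
      unfolding g append_Cons by (rule arg_cong[OF Q(4)[OF h(1)], of "\<lambda>v. nth_deriv f (v # hs @ ts) x"])
    also have "\<dots> = (\<Sum>e\<in>Q. B h e * nth_deriv f (e # hs @ ts) x)"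
      using hs assms(1) Suc.prems Q(2) by (intro nth_deriv_head_sum) auto
    also have "\<bar>\<dots>\<bar> \<le> (\<Sum>e\<in>Q. K e)"
    proof (rule order_trans[OF sum_abs sum_mono])
      fix e assume e: "e \<in> Q"
      then have eE: "e \<in> E" using Q(2) by auto
      have "nrm e = 1" using e Q(3) by (simp add: primal_norm_def)
      then have "\<bar>B h e\<bar> \<le> 1" using Cauchy_Schwarz[OF h(1) eE] h(2) by simp
      moreover have "nth_deriv f (e # hs @ ts) x = nth_deriv f (hs @ e # ts) x"
        using hs assms(1) Suc.prems eE by (intro nth_deriv_mset_cong) auto
      ultimately have "\<bar>B h e * nth_deriv f (e # hs @ ts) x\<bar> \<le> 1 * \<bar>nth_deriv f (hs @ e # ts) x\<bar>"
        unfolding abs_mult by (intro mult_mono) auto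
      then show "\<bar>B h e * nth_deriv f (e # hs @ ts) x\<bar> \<le> K e"
        using K[OF e hs(1,3)] by simp
    qed
    finally show ?thesis .
  qed
  then show ?case by blast
qed auto

lemma unit_direction:
  assumes "h \<in> E"
  obtains k where "k \<in> E" "nrm k \<le> 1" "h = nrm h *\<^sub>R k"
proof -
  have "nrm ((1 / nrm h) *\<^sub>R h) \<le> 1"
    using assms nrm_nonneg[OF assms] by (simp add: nrm_scale)
  moreover have "h = nrm h *\<^sub>R ((1 / nrm h) *\<^sub>R h)"
    using assms nrm_pos[of h] by (cases "h = 0") auto
  ultimately show ?thesis using that[of "(1 / nrm h) *\<^sub>R h"] assms by simp
qed

lemma normalize_directions:
  assumes "length hs + length ts \<le> p" "set hs \<subseteq> E" "set ts \<subseteq> E"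
  shows "\<exists>gs. length gs = length hs \<and> (\<forall>g\<in>set gs. g \<in> E \<and> nrm g \<le> 1) \<and>
          (\<forall>x\<in>E. nth_deriv f (hs @ ts) x = prod_list (map nrm hs) * nth_deriv f (gs @ ts) x)"
  using assms
proof (induction hs arbitrary: ts)
  case (Cons h hs)
  obtain k where k: "k \<in> E" "nrm k \<le> 1" "h = nrm h *\<^sub>R k" using unit_direction[of h] Cons.prems by auto
  obtain gs where gs: "length gs = length hs" "\<forall>g\<in>set gs. g \<in> E \<and> nrm g \<le> 1"
    "\<And>x. x \<in> E \<Longrightarrow> nth_deriv f (hs @ k # ts) x = prod_list (map nrm hs) * nth_deriv f (gs @ k # ts) x"
    using Cons.IH[of "k # ts"] Cons.prems k by auto
  have "nth_deriv f ((h # hs) @ ts) x = prod_list (map nrm (h # hs)) * nth_deriv f ((gs @ [k]) @ ts) x"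
    if x: "x \<in> E" for x
  proof -
    have "nth_deriv f ((h # hs) @ ts) x = nth_deriv f ((nrm h *\<^sub>R k) # hs @ ts) x"
      using k(3) by simp
    also have "\<dots> = nrm h * nth_deriv f (k # hs @ ts) x"
      using x k Cons.prems by (intro nth_deriv_head_scale) auto
    also have "nth_deriv f (k # hs @ ts) x = nth_deriv f (hs @ k # ts) x"
      using x k Cons.prems by (intro nth_deriv_mset_cong) auto
    finally show ?thesis using gs(3)[OF x] by simp
  qed
  then show ?case using gs k by (intro exI[of _ "gs @ [k]"]) auto
qed (auto intro: exI[of _ "[]"])

lemma prod_list_nrm_nonneg: "set hs \<subseteq> E \<Longrightarrow> 0 \<le> prod_list (map nrm hs)"
  by (induction hs) (auto intro: mult_nonneg_nonneg nrm_nonneg)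

lemma holder_bound:
  assumes fin: "holder_const E B f p \<nu> < \<infinity>" and H: "H = enn2real (holder_const E B f p \<nu>)"
    and hs: "length hs = p" "set hs \<subseteq> E" and x: "x \<in> E" and y: "y \<in> E"
  shows "\<bar>nth_deriv f hs x - nth_deriv f hs y\<bar> \<le> H * nrm (x - y) powr \<nu> * prod_list (map nrm hs)"
proof (cases "x = y")
  case True
  then show ?thesis using H hs(2) prod_list_nrm_nonneg by simp
next
  case False
  define U where "U = {hs. length hs = p \<and> (\<forall>h\<in>set hs. h \<in> E \<and> nrm h \<le> 1)}"
  define D where "D hs = nth_deriv f hs x - nth_deriv f hs y" for hs
  have n: "nrm (x - y) > 0" using False x y by (auto intro: nrm_pos)
  obtain gs where gs: "gs \<in> U"
      "\<And>z. z \<in> E \<Longrightarrow> nth_deriv f hs z = prod_list (map nrm hs) * nth_deriv f gs z"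
    using normalize_directions[of hs "[]"] hs unfolding U_def by auto
  obtain K1 where K1: "\<And>hs. hs \<in> U \<Longrightarrow> \<bar>nth_deriv f hs x\<bar> \<le> K1"
    using nth_deriv_bounded_on_unit_ball[OF x, of p "[]"] unfolding U_def by auto
  obtain K2 where K2: "\<And>hs. hs \<in> U \<Longrightarrow> \<bar>nth_deriv f hs y\<bar> \<le> K2"
    using nth_deriv_bounded_on_unit_ball[OF y, of p "[]"] unfolding U_def by auto
  have "bdd_above ((\<lambda>hs. \<bar>D hs\<bar>) ` U)"
  proof (intro bdd_aboveI2[of _ _ "K1 + K2"])
    fix hs assume "hs \<in> U"
    then show "\<bar>D hs\<bar> \<le> K1 + K2" using K1[of hs] K2[of hs] unfolding D_def by linarith
  qed
  then have 1: "\<bar>D gs\<bar> \<le> form_norm E B p D"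
    unfolding form_norm_def U_def[symmetric] using gs(1) by (intro cSUP_upper)
  have "ennreal (form_norm E B p D / nrm (x - y) powr \<nu>) \<le> holder_const E B f p \<nu>"
    unfolding holder_const_def D_def using x y False
    by (intro SUP_upper2[of "(x, y)"]) auto
  also have "\<dots> = ennreal H" using fin H by simp
  finally have "form_norm E B p D / nrm (x - y) powr \<nu> \<le> H"
    using H by (subst (asm) ennreal_le_iff) auto
  then have 2: "form_norm E B p D \<le> H * nrm (x - y) powr \<nu>" using n by (simp add: pos_divide_le_eq)
  have "\<bar>nth_deriv f hs x - nth_deriv f hs y\<bar> = prod_list (map nrm hs) * \<bar>D gs\<bar>"
    unfolding D_def gs(2)[OF x] gs(2)[OF y] right_diff_distrib[symmetric] abs_mult
    using prod_list_nrm_nonneg[OF hs(2)] by simp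
  also have "\<dots> \<le> prod_list (map nrm hs) * (H * nrm (x - y) powr \<nu>)"
    using 1 2 prod_list_nrm_nonneg[OF hs(2)] by (intro mult_left_mono) auto
  finally show ?thesis by (simp add: mult_ac)
qed

text \<open>
  The Lagrange remainder of order \<open>n\<close> is the \<open>n\<close>-th derivative at an intermediate point; trading it for
  the \<open>n\<close>-th Taylor term leaves a difference of \<open>p\<close>-th derivatives of \<open>f\<close>, as \<open>n\<close> and the length of \<open>ks\<close>
  add up to \<open>p\<close>. It is applied to \<open>f\<close> itself (\<open>ks = []\<close>) and to a partial derivative (\<open>ks = [h]\<close>).
\<close>

lemma taylor_remainder_bound:
  assumes fin: "holder_const E B f p \<nu> < \<infinity>" and H: "H = enn2real (holder_const E B f p \<nu>)"
    and \<nu>: "0 \<le> \<nu>" and n: "n + length ks = p" "0 < n" and ks: "set ks \<subseteq> E"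
    and x: "x \<in> E" and u: "u \<in> E"
  shows "\<bar>nth_deriv f ks (x + u) - (\<Sum>i\<le>n. nth_deriv f (replicate i u @ ks) x / fact i)\<bar>
           \<le> H / fact n * (nrm u powr \<nu> * nrm u ^ n) * prod_list (map nrm ks)"
proof -
  define d where "d i t = nth_deriv f (replicate i u @ ks) (x + t *\<^sub>R u)" for i and t :: real
  have "(d i has_real_derivative d (Suc i) t) (at t)" if "i < n" for i t
    unfolding d_def replicate_Suc append_Cons using that n ks x u
    by (intro nth_deriv_along_line) auto
  then obtain \<xi> where \<xi>: "0 < \<xi>" "\<xi> < 1"
      "d 0 1 = (\<Sum>i<n. d i 0 / fact i * 1 ^ i) + d n \<xi> / fact n * 1 ^ n"
    using Maclaurin[of 1 n d "d 0"] n by auto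
  have "d 0 1 - (\<Sum>i\<le>n. d i 0 / fact i) = (d n \<xi> - d n 0) / fact n"
    using \<xi>(3) by (simp add: lessThan_Suc_atMost[symmetric] diff_divide_distrib)
  moreover have "\<bar>d n \<xi> - d n 0\<bar> \<le> H * (nrm u powr \<nu> * nrm u ^ n) * prod_list (map nrm ks)"
  proof -
    have sub: "set (replicate n u @ ks) \<subseteq> E" using ks u by auto
    have "\<bar>d n \<xi> - d n 0\<bar> \<le> H * nrm (x + \<xi> *\<^sub>R u - x) powr \<nu> * prod_list (map nrm (replicate n u @ ks))"
      unfolding d_def using n x u sub holder_bound[OF fin H, of "replicate n u @ ks" "x + \<xi> *\<^sub>R u" x]
      by simp
    also have "\<dots> \<le> H * nrm u powr \<nu> * prod_list (map nrm (replicate n u @ ks))"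
    proof -
      have "nrm (x + \<xi> *\<^sub>R u - x) \<le> nrm u"
        using \<xi> u nrm_nonneg[OF u] by (simp add: nrm_scale mult_left_le_one_le)
      then show ?thesis using \<nu> H prod_list_nrm_nonneg[OF sub] u
        by (intro mult_right_mono mult_left_mono powr_mono2) (auto intro: nrm_nonneg)
    qed
    finally show ?thesis by (simp add: mult_ac)
  qed
  ultimately have "\<bar>d 0 1 - (\<Sum>i\<le>n. d i 0 / fact i)\<bar> \<le>
      H * (nrm u powr \<nu> * nrm u ^ n) * prod_list (map nrm ks) / fact n"
    by (simp add: divide_right_mono)
  then show ?thesis by (simp add: d_def)
qed

lemma taylor_model_eq:
  "taylor_model f p x (x + u) = (\<Sum>i\<le>p. nth_deriv f (replicate i u) x / fact i)"
proof -
  have "{..p} = insert 0 {1..p}" by auto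
  then show ?thesis by (simp add: taylor_model_def)
qed

lemma taylor_model_error:
  assumes fin: "holder_const E B f p \<nu> < \<infinity>" and H: "H = enn2real (holder_const E B f p \<nu>)"
    and \<nu>: "0 \<le> \<nu>" and p: "0 < p" and x: "x \<in> E" and u: "u \<in> E"
  shows "\<bar>f (x + u) - taylor_model f p x (x + u)\<bar> \<le> H / fact p * nrm u powr (real p + \<nu>)"
  using taylor_remainder_bound[OF fin H \<nu>, of p "[]" x u] p x u
  by (simp add: taylor_model_eq power_powr_add nrm_nonneg)

lemma taylor_model_derivative:
  assumes x: "x \<in> E" and u: "u \<in> E" and h: "h \<in> E"
  shows "((\<lambda>t. taylor_model f p x (x + u + t *\<^sub>R h)) has_real_derivative
     (\<Sum>i<p. nth_deriv f (replicate i u @ [h]) x / fact i)) (at 0)"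
proof -
  have "((\<lambda>t. \<Sum>i\<le>p. nth_deriv f (replicate i (u + t *\<^sub>R h) @ []) x / fact i) has_real_derivative
     (\<Sum>i\<le>p. real i * nth_deriv f (replicate (i - 1) u @ [h]) x / fact i)) (at 0)"
    using x u h by (intro DERIV_sum DERIV_cdivide diagonal_form_derivative) auto
  moreover have "(\<Sum>i\<le>p. real i * nth_deriv f (replicate (i - 1) u @ [h]) x / fact i)
      = (\<Sum>i<p. nth_deriv f (replicate i u @ [h]) x / fact i)"
    by (subst sum.atMost_shift) (simp del: of_nat_Suc)
  ultimately show ?thesis using taylor_model_eq[of x "u + _ *\<^sub>R h"] by (simp add: add.assoc)
qed

text \<open>
  At \<open>u = 0\<close> the norm is not differentiable, but its power is, with derivative 0, because the
  exponent exceeds 1. This case matters: it excludes a trial point that coincides with the iterate.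
\<close>

lemma norm_power_derivative:
  assumes u: "u \<in> E" and h: "h \<in> E" and q: "2 \<le> q"
  shows "((\<lambda>t. nrm (u + t *\<^sub>R h) powr q) has_real_derivative q * nrm u powr (q - 2) * B u h) (at 0)"
proof (cases "u = 0")
  case True
  have "((\<lambda>t. \<bar>t\<bar> powr q) has_real_derivative 0) (at 0)"
  proof -
    have "((\<lambda>t::real. \<bar>t\<bar> powr (q - 1)) \<longlongrightarrow> 0) (at 0)"
    proof -
      have "((\<lambda>t::real. \<bar>t\<bar> powr (q - 1)) \<longlongrightarrow> \<bar>0\<bar> powr (q - 1)) (at 0)"
        using q by (intro tendsto_powr' tendsto_intros) (auto simp: eventually_at_filter)
      then show ?thesis using q by simp
    qed
    then have "((\<lambda>t. (\<bar>t\<bar> powr q - \<bar>0\<bar> powr q) / (t - 0)) \<longlongrightarrow> 0) (at 0)"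
    proof (rule Lim_null_comparison[rotated])
      show "eventually (\<lambda>t. norm ((\<bar>t\<bar> powr q - \<bar>0\<bar> powr q) / (t - 0)) \<le> \<bar>t\<bar> powr (q - 1)) (at 0)"
        using q by (auto simp: eventually_at_filter powr_diff)
    qed
    then show ?thesis by (simp add: has_field_derivative_iff)
  qed
  then have "((\<lambda>t. \<bar>t\<bar> powr q * nrm h powr q) has_real_derivative 0 * nrm h powr q) (at 0)"
    by (rule DERIV_cmult_right)
  then show ?thesis using True h by (simp add: nrm_scale powr_mult nrm_nonneg)
next
  case False
  have n: "nrm u > 0" using False u nrm_pos by auto
  then have B: "B u u > 0" using False u B_pos by auto
  have "((\<lambda>t. sqrt (B u u + 2 * t * B u h + t\<^sup>2 * B h h) powr q) has_real_derivative
     q * nrm u powr (q - 1) * (B u h / nrm u)) (at 0)"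
    using B n unfolding primal_norm_def
    by (auto intro!: derivative_eq_intros simp: powr_diff field_simps)
  moreover have "q * nrm u powr (q - 1) * (B u h / nrm u) = q * nrm u powr (q - 2) * B u h"
    using n by (simp add: powr_diff power2_eq_square field_simps)
  ultimately show ?thesis
    using quadratic_expand[OF u h] by (simp add: primal_norm_def)
qed

lemma gradient_reg_model:
  assumes x: "x \<in> E" and u: "u \<in> E" and h: "h \<in> E" and p: "2 \<le> p" and \<alpha>: "0 \<le> \<alpha>"
  shows "gradient (reg_model B f p \<alpha> M x) (x + u) h =
    (\<Sum>i<p. nth_deriv f (replicate i u @ [h]) x / fact i)
    + M / fact p * ((real p + \<alpha>) * nrm u powr (real p + \<alpha> - 2) * B u h)"
proof -
  have "((\<lambda>t. taylor_model f p x (x + u + t *\<^sub>R h) + M / fact p * nrm (u + t *\<^sub>R h) powr (real p + \<alpha>))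
    has_real_derivative (\<Sum>i<p. nth_deriv f (replicate i u @ [h]) x / fact i)
    + M / fact p * ((real p + \<alpha>) * nrm u powr (real p + \<alpha> - 2) * B u h)) (at 0)"
    using x u h p \<alpha> by (intro DERIV_add DERIV_cmult taylor_model_derivative norm_power_derivative) auto
  then show ?thesis
    by (simp add: gradient_def nth_deriv.simps(2) reg_model_def DERIV_imp_deriv algebra_simps)
qed

lemma linear_functional_gradient:
  assumes "x \<in> E" "0 < p"
  shows "linear_functional_on E (gradient f x)"
  using nth_deriv_head_add_scaled[of "[]" x _ _ 1] nth_deriv_head_scale[of "[]" x] assms
  by (simp add: linear_functional_on_def gradient_def)

lemma linear_functional_gradient_reg_model:
  assumes x: "x \<in> E" and u: "u \<in> E" and p: "2 \<le> p" and \<alpha>: "0 \<le> \<alpha>"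
  shows "linear_functional_on E (gradient (reg_model B f p \<alpha> M x) (x + u))"
proof -
  have mv: "nth_deriv f (replicate i u @ [h]) x = nth_deriv f (h # replicate i u) x"
    if "i < p" "h \<in> E" for i h
    using nth_deriv_move_to_head[of "replicate i u" h "[]"] that x u by (simp add: set_replicate_conv_if)
  have add: "nth_deriv f (replicate i u @ [h + k]) x
      = nth_deriv f (replicate i u @ [h]) x + nth_deriv f (replicate i u @ [k]) x"
    if "i < p" "h \<in> E" "k \<in> E" for i h k
    using that x u nth_deriv_head_add_scaled[of "replicate i u" x h k 1] by (simp add: mv set_replicate_conv_if)
  have scale: "nth_deriv f (replicate i u @ [c *\<^sub>R h]) x = c * nth_deriv f (replicate i u @ [h]) x"
    if "i < p" "h \<in> E" for i h c
    using that x u nth_deriv_head_scale[of "replicate i u" x h c] by (simp add: mv set_replicate_conv_if)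
  show ?thesis
    unfolding linear_functional_on_def
    using x u p \<alpha>
    by (auto simp: gradient_reg_model add scale B_add_right B_scale_right sum.distrib
        sum_distrib_left add_divide_distrib ring_distribs mult.left_commute)
qed

text \<open>
  The gradient of \<open>f\<close> differs from that of the regularized model by the Taylor error of the
  directional derivative and by the gradient of the regularization term.
\<close>

lemma gradient_norm_bound:
  assumes fin: "holder_const E B f p \<nu> < \<infinity>" and H: "H = enn2real (holder_const E B f p \<nu>)"
    and \<nu>: "0 \<le> \<nu>" and p: "2 \<le> p" and \<alpha>: "0 \<le> \<alpha>" and x: "x \<in> E" and u: "u \<in> E" and M: "0 \<le> M"
    and \<theta>: "dual_norm E B (gradient (reg_model B f p \<alpha> M x) (x + u)) \<le> \<theta> * nrm u powr (real p + \<alpha> - 1)"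
    and "0 \<le> \<theta>"
  shows "dual_norm E B (gradient f (x + u)) \<le>
    H / fact (p - 1) * nrm u powr (real p + \<nu> - 1)
    + (\<theta> + M * (real p + \<alpha>) / fact p) * nrm u powr (real p + \<alpha> - 1)" (is "_ \<le> ?R")
proof (rule dual_norm_le)
  show "linear_functional_on E (gradient f (x + u))"
    using x u p by (intro linear_functional_gradient) auto
  show "0 \<le> ?R" using assms by auto
  fix h assume h: "h \<in> E"
  define r where "r = nrm u"
  have r: "0 \<le> r" using nrm_nonneg[OF u] r_def by simp
  define S where "S = (\<Sum>i<p. nth_deriv f (replicate i u @ [h]) x / fact i)"
  define W where "W = gradient (reg_model B f p \<alpha> M x) (x + u) h"
  define V where "V = M / fact p * ((real p + \<alpha>) * r powr (real p + \<alpha> - 2) * B u h)"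
  have W: "W = S + V"
    unfolding W_def S_def V_def r_def by (rule gradient_reg_model[OF x u h p \<alpha>])
  have "\<bar>nth_deriv f [h] (x + u) - (\<Sum>i\<le>p-1. nth_deriv f (replicate i u @ [h]) x / fact i)\<bar>
      \<le> H / fact (p - 1) * (r powr \<nu> * r ^ (p - 1)) * prod_list (map nrm [h])"
    unfolding r_def using p x u h by (intro taylor_remainder_bound[OF fin H \<nu>]) auto
  moreover have "{..p-1} = {..<p}" using p by auto
  moreover have "r powr \<nu> * r ^ (p - 1) = r powr (real p + \<nu> - 1)"
    using r p by (simp add: power_powr_add algebra_simps)
  ultimately have 1: "\<bar>gradient f (x + u) h - S\<bar> \<le> H / fact (p - 1) * r powr (real p + \<nu> - 1) * nrm h"
    by (simp add: S_def gradient_def)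
  have "\<bar>W\<bar> \<le> dual_norm E B (gradient (reg_model B f p \<alpha> M x) (x + u)) * nrm h"
    unfolding W_def by (rule dual_norm_bound[OF linear_functional_gradient_reg_model[OF x u p \<alpha>] h])
  also have "\<dots> \<le> \<theta> * r powr (real p + \<alpha> - 1) * nrm h"
    unfolding r_def using \<theta> nrm_nonneg[OF h] by (rule mult_right_mono)
  finally have 2: "\<bar>W\<bar> \<le> \<theta> * r powr (real p + \<alpha> - 1) * nrm h" .
  have "\<bar>V\<bar> = M / fact p * ((real p + \<alpha>) * r powr (real p + \<alpha> - 2) * \<bar>B u h\<bar>)"
    unfolding V_def using M \<alpha> by (simp add: abs_mult)
  also have "\<dots> \<le> M / fact p * ((real p + \<alpha>) * r powr (real p + \<alpha> - 2) * (r * nrm h))"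
    using Cauchy_Schwarz[OF u h] M \<alpha> unfolding r_def by (intro mult_left_mono) auto
  also have "\<dots> = M * (real p + \<alpha>) / fact p * (r powr (real p + \<alpha> - 2) * r ^ 1) * nrm h"
    by simp
  also have "r powr (real p + \<alpha> - 2) * r ^ 1 = r powr (real p + \<alpha> - 1)"
    using r by (subst power_powr_add) (auto simp: algebra_simps)
  finally have 3: "\<bar>V\<bar> \<le> M * (real p + \<alpha>) / fact p * r powr (real p + \<alpha> - 1) * nrm h" .
  have "\<bar>gradient f (x + u) h\<bar> \<le> \<bar>gradient f (x + u) h - S\<bar> + \<bar>W\<bar> + \<bar>V\<bar>" using W by linarith
  also have "\<dots> \<le> ?R * nrm h" using 1 2 3 by (simp add: r_def algebra_simps)
  finally show "\<bar>gradient f (x + u) h\<bar> \<le> ?R * nrm h" .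
qed

section \<open>Rejected regularization parameters\<close>

text \<open>
  With \<open>w = r powr (\<alpha> - \<nu>)\<close>, every estimate becomes one in the product \<open>M * w\<close>. The constant 8 of the
  acceptance test leaves just enough room: the gradient is at most \<open>3 * M * r powr (p + \<alpha> - 1)\<close>, its power
  has an exponent of at most 2, which costs a factor 9, and \<open>9 / (8 * (p + 1)) \<le> 1 / 2\<close> for \<open>p \<ge> 2\<close>.
\<close>

lemma rejected_parameter_bound:
  assumes fin: "holder_const E B f p \<nu> < \<infinity>" and H: "enn2real (holder_const E B f p \<nu>) \<le> H"
    and H0: "0 < H" and p: "2 \<le> p" and \<nu>: "0 \<le> \<nu>" and \<alpha>: "\<nu> \<le> \<alpha>" "\<alpha> \<le> 1"
    and \<theta>: "0 \<le> \<theta>" "\<theta> \<le> M" and M: "0 < M" and \<epsilon>: "0 < \<epsilon>" and x: "x \<in> E"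
    and approx: "approx_solution E B f p \<alpha> \<theta> M x y"
    and rejected: "\<not> accepted E B f p \<alpha> \<epsilon> M x y"
  shows "M \<le> 2 * H * (6 * H / \<epsilon>) powr ((\<alpha> - \<nu>) / (real p + \<nu> - 1))"
proof -
  define k where "k = real p + \<nu> - 1"
  define m where "m = real p + \<alpha> - 1"
  define F where "F = (fact p :: real)"
  have k: "1 \<le> k" and m: "1 \<le> m" and p2: "2 \<le> real p" using p \<nu> \<alpha> by (auto simp: k_def m_def)
  have "real p \<le> real (fact p)" using fact_ge_self by (simp only: of_nat_le_iff)
  then have F: "real p \<le> F" "0 < F" by (auto simp: F_def)
  have F1: "fact (p - 1) = F / real p" using p by (simp add: F_def fact_reduce)
  define u where "u = y - x"
  have yE: "y \<in> E" using approx by (simp add: approx_solution_def)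
  have y: "y = x + u" and u: "u \<in> E" using x yE by (auto simp: u_def)
  define r where "r = nrm u"
  define g where "g = dual_norm E B (gradient f y)"
  have g\<epsilon>: "\<epsilon> < g" using rejected by (auto simp: accepted_def g_def)
  define w where "w = r powr (\<alpha> - \<nu>)"
  have "g \<le> enn2real (holder_const E B f p \<nu>) / fact (p - 1) * r powr k
      + (\<theta> + M * (real p + \<alpha>) / F) * r powr m"
    unfolding g_def y k_def m_def r_def F_def using approx \<theta> M p \<nu> \<alpha> x u fin
    by (intro gradient_norm_bound) (auto simp: approx_solution_def u_def)
  also have "\<dots> \<le> H / fact (p - 1) * r powr k + (\<theta> + M * (real p + \<alpha>) / F) * r powr m"
    using H by (intro add_right_mono mult_right_mono divide_right_mono) auto
  also have "H / fact (p - 1) = H * (real p / F)" unfolding F1 by simp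
  finally have g1: "g \<le> H * (real p / F) * r powr k + (\<theta> + M * (real p + \<alpha>) / F) * r powr m" .
  \<comment> \<open>If the trial point were the iterate, both powers of \<open>r\<close> would vanish and so would the gradient.\<close>
  have r: "0 < r"
  proof (rule ccontr)
    assume "\<not> 0 < r"
    then have "r = 0" using nrm_nonneg[OF u] by (simp add: r_def)
    then show False using g1 g\<epsilon> \<epsilon> by simp
  qed
  have w: "0 < w" using r by (simp add: w_def)
  have "m = k + (\<alpha> - \<nu>)" by (simp add: m_def k_def)
  then have rm: "r powr m = r powr k * w" by (simp add: w_def powr_add)
  have pF: "real p / F \<le> 1" "0 \<le> real p / F" using F by auto
  define K where "K = \<theta> + M * (real p + \<alpha>) / F"
  have K: "K \<le> 5 / 2 * M"
  proof -
    have "(real p + \<alpha>) / F \<le> 3 / 2" using F p2 \<alpha> by (simp add: pos_divide_le_eq)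
    then show ?thesis using \<theta> M mult_left_mono[of "(real p + \<alpha>) / F" "3/2" M] by (simp add: K_def)
  qed
  have "g \<le> H * (real p / F) * r powr k + K * (w * r powr k)"
    using g1 unfolding K_def[symmetric] rm by (simp only: mult.commute[of w])
  also have "\<dots> \<le> H * (real p / F) * r powr k + 5 / 2 * M * (w * r powr k)"
    using K r w by (intro add_left_mono mult_right_mono) auto
  finally have g2: "g \<le> (H * (real p / F) + 5 / 2 * (M * w)) * r powr k"
    by (simp add: algebra_simps)
  have g3: "g \<le> (H + 5 / 2 * (M * w)) * r powr k"
  proof (rule order_trans[OF g2 mult_right_mono])
    show "H * (real p / F) + 5 / 2 * (M * w) \<le> H + 5 / 2 * (M * w)"
      using mult_left_mono[OF pF(1), of H] H0 by simp
  qed simp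
  have Mw: "M * w < 2 * H"
  proof (rule ccontr)
    assume "\<not> M * w < 2 * H"
    then have HM: "H \<le> M * w / 2" by simp
    have "(H + 5 / 2 * (M * w)) * r powr k \<le> 3 * M * (w * r powr k)"
      using mult_right_mono[of "H + 5 / 2 * (M * w)" "3 * M * w" "r powr k"] HM by (simp add: mult.assoc)
    then have g4: "g \<le> 3 * M * r powr m" using g3 by (simp add: rm mult_ac)
    define q where "q = (real p + \<alpha>) / m"
    have q: "1 \<le> q" "q \<le> 2" "q = 1 + 1 / m" using m p2 by (auto simp: q_def m_def field_simps)
    have rp: "r powr (real p + \<alpha>) = r powr (real p + \<nu>) * w"
      using r by (simp add: w_def powr_add[symmetric])
    have "f y \<le> taylor_model f p x y
        + enn2real (holder_const E B f p \<nu>) / F * r powr (real p + \<nu>)"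
      using taylor_model_error[OF fin refl \<nu> _ x u] p by (simp add: y r_def F_def)
    also have "\<dots> \<le> taylor_model f p x y + H / F * r powr (real p + \<nu>)"
      using H F by (intro add_left_mono mult_right_mono divide_right_mono) auto
    also have "\<dots> \<le> taylor_model f p x y + (M * w / 2) / F * r powr (real p + \<nu>)"
      using HM F by (intro add_left_mono mult_right_mono divide_right_mono) auto
    also have "\<dots> = taylor_model f p x y + M / (2 * F) * r powr (real p + \<alpha>)"
      by (simp add: rp)
    also have "\<dots> = reg_model B f p \<alpha> M x y - M / (2 * F) * r powr (real p + \<alpha>)"
      by (simp add: reg_model_def r_def u_def F_def field_simps)
    also have "\<dots> \<le> f x - M / (2 * F) * r powr (real p + \<alpha>)"
      using approx by (simp add: approx_solution_def)
    finally have dec: "M / (2 * F) * r powr (real p + \<alpha>) \<le> f x - f y" by simp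
    have "g powr q \<le> (3 * M * r powr m) powr q"
      using g4 g\<epsilon> \<epsilon> q by (intro powr_mono2) auto
    also have "\<dots> = 3 powr q * (M powr (1 / m) * M) * r powr (real p + \<alpha>)"
    proof -
      have "m * q = real p + \<alpha>" using m by (simp add: q_def)
      moreover have "M powr q = M powr (1 / m) * M" using M by (simp add: q(3) powr_add)
      ultimately show ?thesis using M r by (simp add: powr_mult powr_powr)
    qed
    also have "\<dots> \<le> 9 * (M powr (1 / m) * M) * r powr (real p + \<alpha>)"
    proof -
      have "3 powr q \<le> 3 powr (2::real)" using q by (intro powr_mono) auto
      also have "\<dots> = (9::real)" by simp
      finally show ?thesis using M by (intro mult_right_mono) auto
    qed
    finally have gq: "g powr q \<le> 9 * (M powr (1 / m) * M) * r powr (real p + \<alpha>)" .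
    define P where "P = M powr (1 / m)"
    have P: "0 < P" using M by (simp add: P_def)
    have "1 / (8 * fact (p + 1) * P) * g powr q
        \<le> 1 / (8 * fact (p + 1) * P) * (9 * (P * M) * r powr (real p + \<alpha>))"
      using gq P by (intro mult_left_mono) (auto simp: P_def)
    also have "\<dots> = 9 / (8 * (real p + 1)) * (M / F * r powr (real p + \<alpha>))"
    proof -
      have "(fact (p + 1) :: real) = (real p + 1) * F" by (simp add: F_def algebra_simps)
      then show ?thesis using P F by (simp only:) simp
    qed
    also have "\<dots> \<le> 1 / 2 * (M / F * r powr (real p + \<alpha>))"
      using M F p2 by (intro mult_right_mono) (auto simp: field_simps)
    also have "\<dots> \<le> f x - f y" using dec by simp
    finally have "accepted E B f p \<alpha> \<epsilon> M x y"
      by (simp add: accepted_def P_def m_def g_def q_def)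
    then show False using rejected by simp
  qed
  \<comment> \<open>Now \<open>M * w\<close> is bounded, so the gradient, still above \<open>\<epsilon>\<close>, bounds \<open>r\<close> from below.\<close>
  have "g \<le> 6 * H * r powr k"
    using g3 by (rule order_trans) (use Mw in \<open>intro mult_right_mono, auto\<close>)
  then have rk: "\<epsilon> / (6 * H) \<le> r powr k" using g\<epsilon> H0 by (simp add: pos_divide_le_eq mult_ac)
  have "M \<le> 2 * H * (1 / w)" using Mw w by (simp add: pos_le_divide_eq)
  also have "1 / w = (r powr k) powr (- ((\<alpha> - \<nu>) / k))"
    using r k by (simp add: w_def powr_powr powr_minus_divide[symmetric])
  also have "\<dots> \<le> (\<epsilon> / (6 * H)) powr (- ((\<alpha> - \<nu>) / k))"
    using rk \<epsilon> H0 \<alpha> k by (intro powr_mono2') auto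
  also have "\<dots> = (6 * H / \<epsilon>) powr ((\<alpha> - \<nu>) / k)"
    using \<epsilon> H0 by (simp add: powr_minus powr_divide)
  finally show ?thesis using H0 by (simp add: k_def)
qed

section \<open>Counting iterations\<close>

text \<open>
  The parameter handed to the next iteration is half of the accepted one: this is half of the
  current parameter if the first trial succeeds and the last rejected one otherwise, so it never exceeds the larger of \<open>H 0\<close> and \<open>R\<close>.
\<close>

lemma backtracking_bound:
  fixes H :: "nat \<Rightarrow> real"
  assumes H0: "0 < H 0"
    and rejected: "\<And>t j. \<lbrakk>t < T; j < i t; 0 < H t\<rbrakk> \<Longrightarrow> 2 ^ j * H t \<le> R"
    and update: "\<And>t. t < T \<Longrightarrow> H (Suc t) = 2 powi (int (i t) - 1) * H t"
    and t: "t < T"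
  shows "0 < H t \<and> 2 ^ i t * H t \<le> max (H 0) (2 * R)"
proof -
  have step: "H (Suc t) = 2 ^ i t * H t / 2" if "t < T" for t
    using update[OF that] by (simp add: power_int_diff)
  have half: "2 ^ i t * H t / 2 \<le> R" if "t < T" "0 < H t" "i t \<noteq> 0" for t
    using rejected[of t "i t - 1"] that by (cases "i t") auto
  have inv: "0 < H t \<and> H t \<le> max (H 0) R" if "t \<le> T" for t
    using that
  proof (induction t)
    case (Suc t)
    then have "0 < H t" "H t \<le> max (H 0) R" "t < T" by auto
    then have "0 < H (Suc t)" "H (Suc t) \<le> max (H 0) R"
      unfolding step[OF \<open>t < T\<close>] using half[of t] by (simp, cases "i t = 0", auto)
    then show ?case ..
  qed (use H0 in auto)
  show ?thesis
    using inv[of t] half[of t] t by (cases "i t = 0") auto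
qed

text \<open>
  Assuming \<open>H \<ge> 1\<close> rather than \<open>H > 0\<close> allows \<open>\<alpha>\<close> to be replaced by 1 in the exponent of \<open>6 * H\<close>, and
  the summand 1 next to \<open>H\<^sub>0\<close> allows the exponent \<open>1 / (p + \<alpha> - 1)\<close> to be dropped; so the constant
  does not depend on \<open>\<alpha>\<close>.
\<close>

lemma iteration_count_bound:
  assumes fin: "holder_const E B f p \<nu> < \<infinity>" and H: "enn2real (holder_const E B f p \<nu>) \<le> H"
    and H1: "1 \<le> H" and p: "2 \<le> p" and \<nu>: "0 \<le> \<nu>" and \<alpha>: "\<nu> \<le> \<alpha>" "\<alpha> \<le> 1"
    and \<theta>: "0 \<le> \<theta>" and H0: "0 < H\<^sub>0" and \<epsilon>: "0 < \<epsilon>" "\<epsilon> < 1"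
    and low: "\<And>y. y \<in> E \<Longrightarrow> fstar \<le> f y"
    and iter: "tensor_method_iterates E B f p \<alpha> \<theta> \<epsilon> H\<^sub>0 T x"
    and grad: "\<And>t. t \<le> T \<Longrightarrow> \<epsilon> < dual_norm E B (gradient f (x t))"
  shows "real T \<le> 8 * fact (p + 1)
      * (H\<^sub>0 + 1 + 2 * (\<theta> + 2 * H * (6 * H) powr ((1 - \<nu>) / (real p + \<nu> - 1))))
      * (f (x 0) - fstar) * \<epsilon> powr (- ((real p + \<nu>) / (real p + \<nu> - 1)))"
proof -
  define k where "k = real p + \<nu> - 1"
  define m where "m = real p + \<alpha> - 1"
  define s where "s = (\<alpha> - \<nu>) / k"
  define q where "q = (real p + \<nu>) / k"
  define A where "A = \<theta> + 2 * H * (6 * H) powr ((1 - \<nu>) / k)"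
  define P where "P = H\<^sub>0 + 1 + 2 * A"
  define R where "R = \<theta> + 2 * H * (6 * H / \<epsilon>) powr s"
  have k: "1 \<le> k" and m: "1 \<le> m" using p \<nu> \<alpha> by (auto simp: k_def m_def)
  have s: "0 \<le> s" using k \<alpha> by (simp add: s_def)
  have A: "0 \<le> A" using \<theta> H1 by (simp add: A_def)
  have P: "1 \<le> P" using A H0 by (simp add: P_def)
  define z where "z = \<epsilon> powr (- s)"
  have z: "1 \<le> z" using \<epsilon> s powr_mono'[of "- s" 0 \<epsilon>] by (simp add: z_def)
  have RA: "R \<le> A * z"
  proof -
    have "(6 * H / \<epsilon>) powr s = (6 * H) powr s * z"
      using \<epsilon> H1 by (simp add: powr_divide z_def powr_minus_divide)
    also have "\<dots> \<le> (6 * H) powr ((1 - \<nu>) / k) * z"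
      using H1 \<alpha> k z by (intro mult_right_mono powr_mono) (auto simp: s_def divide_right_mono)
    finally have "2 * H * (6 * H / \<epsilon>) powr s \<le> 2 * H * ((6 * H) powr ((1 - \<nu>) / k) * z)"
      using H1 by (intro mult_left_mono) auto
    moreover have "\<theta> \<le> \<theta> * z" using \<theta> z mult_left_mono[of 1 z \<theta>] by simp
    ultimately show ?thesis by (simp add: R_def A_def algebra_simps)
  qed
  obtain Hs i xp where x0: "x 0 \<in> E" and Hs0: "Hs 0 = H\<^sub>0" and
    approx: "\<And>t j. \<lbrakk>t < T; j \<le> i t\<rbrakk> \<Longrightarrow> approx_solution E B f p \<alpha> \<theta> (2 ^ j * Hs t) (x t) (xp t j)" and
    rej: "\<And>t j. \<lbrakk>t < T; j < i t\<rbrakk> \<Longrightarrow> \<not> accepted E B f p \<alpha> \<epsilon> (2 ^ j * Hs t) (x t) (xp t j)" and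
    acc: "\<And>t. t < T \<Longrightarrow> accepted E B f p \<alpha> \<epsilon> (2 ^ i t * Hs t) (x t) (xp t (i t))" and
    next_x: "\<And>t. t < T \<Longrightarrow> x (Suc t) = xp t (i t)" and
    next_H: "\<And>t. t < T \<Longrightarrow> Hs (Suc t) = 2 powi (int (i t) - 1) * Hs t"
    using iter unfolding tensor_method_iterates_def by blast
  have xE: "x t \<in> E" if "t \<le> T" for t
    using that x0 approx[of "t - 1" "i (t - 1)"] next_x[of "t - 1"]
    by (cases t) (auto simp: approx_solution_def)
  have R0: "0 \<le> 2 * H * (6 * H / \<epsilon>) powr s" using H1 by simp
  have rejR: "2 ^ j * Hs t \<le> R" if t: "t < T" "j < i t" "0 < Hs t" for t j
  proof (cases "\<theta> \<le> 2 ^ j * Hs t")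
    case True
    have "2 ^ j * Hs t \<le> 2 * H * (6 * H / \<epsilon>) powr s"
      unfolding s_def k_def
      using approx[of t j] rej[of t j] xE[of t] t True H H1 p \<nu> \<alpha> \<theta> \<epsilon>
      by (intro rejected_parameter_bound[OF fin]) auto
    then show ?thesis using \<theta> by (simp add: R_def)
  qed (use R0 in \<open>simp add: R_def\<close>)
  have Mb: "0 < Hs t \<and> 2 ^ i t * Hs t \<le> P * z" if t: "t < T" for t
  proof -
    have "0 < Hs t \<and> 2 ^ i t * Hs t \<le> max (Hs 0) (2 * R)"
      by (rule backtracking_bound[where H = Hs and i = i and R = R and T = T, OF _ rejR next_H t]) (use H0 Hs0 in auto)
    moreover have "max (Hs 0) (2 * R) \<le> P * z"
    proof -
      have "H\<^sub>0 + 2 * (A * z) \<le> P * z" "0 \<le> A * z"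
        using z H0 A mult_left_mono[of 1 z "H\<^sub>0 + 1"] by (auto simp: P_def distrib_right)
      then show ?thesis using RA H0 Hs0 by auto
    qed
    ultimately show ?thesis by linarith
  qed
  define c where "c = 1 / (8 * fact (p + 1) * P) * \<epsilon> powr q"
  have dec: "c \<le> f (x t) - f (x (Suc t))" if t: "t < T" for t
  proof -
    define M where "M = 2 ^ i t * Hs t"
    have M: "0 < M" "M \<le> P * z" using Mb[OF t] by (auto simp: M_def)
    define g where "g = dual_norm E B (gradient f (x (Suc t)))"
    have g: "\<epsilon> < g" using grad[of "Suc t"] t by (simp add: g_def)
    have "M powr (1 / m) \<le> (P * z) powr (1 / m)"
      using M m by (intro powr_mono2) auto
    also have "\<dots> = P powr (1 / m) * \<epsilon> powr (- (s / m))"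
      using P by (simp add: powr_mult z_def powr_powr)
    also have "\<dots> \<le> P * \<epsilon> powr (- (s / m))"
      using P m powr_mono[of "1 / m" 1 P] by (intro mult_right_mono) auto
    finally have Mm: "M powr (1 / m) \<le> P * \<epsilon> powr (- (s / m))" .
    \<comment> \<open>The exponents of \<open>\<epsilon>\<close> from the parameter bound and from the test add up to one free of \<open>\<alpha>\<close>.\<close>
    have expo: "q = s / m + (real p + \<alpha>) / m"
    proof -
      have "(real p + \<nu>) * m = (\<alpha> - \<nu>) + (real p + \<alpha>) * k"
        by (simp add: m_def k_def algebra_simps)
      then have "(real p + \<nu>) * m / (k * m) = ((\<alpha> - \<nu>) + (real p + \<alpha>) * k) / (k * m)" by simp
      then show ?thesis using k m by (simp add: q_def s_def add_divide_distrib)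
    qed
    have "c = 1 / (8 * fact (p + 1) * (P * \<epsilon> powr (- (s / m)))) * \<epsilon> powr ((real p + \<alpha>) / m)"
      using \<epsilon> P by (simp add: c_def expo powr_add powr_minus field_simps)
    also have "\<dots> \<le> 1 / (8 * fact (p + 1) * M powr (1 / m)) * g powr ((real p + \<alpha>) / m)"
      using Mm M P g \<epsilon> m p \<alpha> \<nu> by (intro mult_mono powr_mono2 divide_left_mono mult_left_mono) auto
    also have "\<dots> \<le> f (x t) - f (x (Suc t))"
      using acc[OF t] next_x[OF t] g by (auto simp: accepted_def M_def g_def m_def)
    finally show ?thesis .
  qed
  have "real T * c \<le> (\<Sum>t<T. f (x t) - f (x (Suc t)))"
    using sum_mono[of "{..<T}" "\<lambda>_. c"] dec by simp
  also have "\<dots> = f (x 0) - f (x T)" by (rule sum_lessThan_telescope')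
  also have "\<dots> \<le> f (x 0) - fstar" using low[OF xE[of T]] by simp
  finally have "real T * c \<le> f (x 0) - fstar" .
  then have "real T * c * (8 * fact (p + 1) * P * \<epsilon> powr (- q))
      \<le> (f (x 0) - fstar) * (8 * fact (p + 1) * P * \<epsilon> powr (- q))"
    using P by (intro mult_right_mono) auto
  moreover have "c * (8 * fact (p + 1) * P * \<epsilon> powr (- q)) = 1"
  proof -
    have "8 * fact (p + 1) * P \<noteq> 0" "\<epsilon> powr q \<noteq> 0" using P \<epsilon> by auto
    moreover have "1 / a * e * (a * inverse e) = 1" if "a \<noteq> 0" "e \<noteq> 0" for a e :: real
      using that by simp
    ultimately show ?thesis unfolding c_def powr_minus by blast
  qed
  ultimately have "real T \<le> (f (x 0) - fstar) * (8 * fact (p + 1) * P * \<epsilon> powr (- q))"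
    by (simp only: mult.assoc mult_1_right)
  then show ?thesis by (simp add: P_def A_def q_def k_def mult_ac)
qed

end

section \<open>The complexity bound\<close>

theorem mainTheorem2:
  shows "\<exists>C :: nat \<Rightarrow> real \<Rightarrow> real \<Rightarrow> real \<Rightarrow> real \<Rightarrow> real \<Rightarrow> real.
    \<forall>(E :: 'a::real_normed_vector set) (B :: 'a \<Rightarrow> 'a \<Rightarrow> real) (f :: 'a \<Rightarrow> real) (p :: nat)
      (\<nu> :: real) (\<alpha> :: real) (\<theta> :: real) (H\<^sub>0 :: real) (fstar :: real) (\<epsilon> :: real) (T :: nat)
      (x :: nat \<Rightarrow> 'a).
      finite_dim_space E \<longrightarrow>
      self_adjoint_pos_def_on E B \<longrightarrow>
      p \<ge> 2 \<longrightarrow>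
      times_differentiable_on p f E \<longrightarrow>
      (\<forall>y\<in>E. fstar \<le> f y) \<longrightarrow>
      \<nu> \<in> {0..1} \<longrightarrow>
      holder_const E B f p \<nu> < \<infinity> \<longrightarrow>
      \<alpha> = \<nu> \<or> \<alpha> = 1 \<longrightarrow>
      \<theta> \<ge> 0 \<longrightarrow>
      H\<^sub>0 > 0 \<longrightarrow>
      \<epsilon> \<in> {0<..<1} \<longrightarrow>
      tensor_method_iterates E B f p \<alpha> \<theta> \<epsilon> H\<^sub>0 T x \<longrightarrow>
      (\<forall>t\<le>T. dual_norm E B (gradient f (x t)) > \<epsilon>) \<longrightarrow>
      real T \<le> C p \<nu> \<theta> H\<^sub>0 (enn2real (holder_const E B f p \<nu>)) (f (x 0) - fstar)
                 * \<epsilon> powr (- ((real p + \<nu>) / (real p + \<nu> - 1)))"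
proof -
  \<comment> \<open>The Hoelder constant may vanish; adding 1 provides the positive \<open>H \<ge> 1\<close> of the iteration bound.\<close>
  define C :: "nat \<Rightarrow> real \<Rightarrow> real \<Rightarrow> real \<Rightarrow> real \<Rightarrow> real \<Rightarrow> real" where
    "C p \<nu> \<theta> H\<^sub>0 Hf \<Delta> = 8 * fact (p + 1)
      * (H\<^sub>0 + 1 + 2 * (\<theta> + 2 * (Hf + 1) * (6 * (Hf + 1)) powr ((1 - \<nu>) / (real p + \<nu> - 1))))
      * \<Delta>" for p \<nu> \<theta> H\<^sub>0 Hf \<Delta>
  show ?thesis
  proof (rule exI[of _ C], intro allI impI)
    fix E :: "'a set" and B f p \<nu> \<alpha> \<theta> H\<^sub>0 fstar \<epsilon> T x
    assume a: "finite_dim_space E" "self_adjoint_pos_def_on E B" "2 \<le> p" "times_differentiable_on p f E"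
      "\<forall>y\<in>E. fstar \<le> f y" "\<nu> \<in> {0..1}" "holder_const E B f p \<nu> < \<infinity>" "\<alpha> = \<nu> \<or> \<alpha> = 1" "0 \<le> \<theta>"
      "0 < H\<^sub>0" "\<epsilon> \<in> {0<..<1}" "tensor_method_iterates E B f p \<alpha> \<theta> \<epsilon> H\<^sub>0 T x"
      "\<forall>t\<le>T. \<epsilon> < dual_norm E B (gradient f (x t))"
    interpret pos_def_space E B using a by unfold_locales
    interpret smooth_on_pos_def_space E B f p using a subspace_E by unfold_locales
    show "real T \<le> C p \<nu> \<theta> H\<^sub>0 (enn2real (holder_const E B f p \<nu>)) (f (x 0) - fstar)
                 * \<epsilon> powr (- ((real p + \<nu>) / (real p + \<nu> - 1)))"
      unfolding C_def using a by (intro iteration_count_bound[where \<alpha> = \<alpha>]) auto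
  qed
qed

end
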